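(* Let $r\ge1$. (i) Let $f\colon\mathcal M_{d\times d}\to\mathbb R$ be the log matrix determinant $f(\mathbf X)=\log|\mathbf X|$ for all non-singular $\mathbf X$. Then the $r$th derivative of $\log|\mathbf X|$ is $$\mathsf D^{\otimes r}\log|\mathbf X|=(-1)^{r-1}(r-1)!\,\boldsymbol{\mathcal S}_{d^2,r}\mathbf K_{d,d^{2r-1}}(\operatorname{vec}\mathbf X^{-1})^{\otimes r}\in\mathbb R^{d^{2r}}.$$ (ii) Let $f\colon\mathcal M_{d\times d}\to\mathbb R$ be the matrix determinant $f(\mathbf X)=|\mathbf X|$ for all non-singular $\mathbf X$. Then the $r$th derivative of $|\mathbf X|$ is $$\mathsf D^{\otimes r}|\mathbf X|=|\mathbf X|\,\boldsymbol{\mathcal S}_{d^2,r}\boldsymbol\Xi_{d,r}(\operatorname{vec}\mathbf X^{-1})^{\otimes r}\in\mathbb R^{d^{2r}},$$ where $$\boldsymbol\Xi_{d,r}=\sum_{\boldsymbol m\in\mathcal J_r}(-1)^{r-|\boldsymbol m|}\frac{r!}{\prod_{\ell=1}^r(m_\ell!\,\ell^{m_\ell})}\bigotimes_{\ell=1}^r\mathbf K_{d,d^{2\ell-1}}^{\otimes m_\ell}\in\mathcal M_{d^{2r}\times d^{2r}}.$$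
   Context: $|\mathbf X|$ denotes the determinant of $\mathbf X$. $\mathcal J_r=\{\boldsymbol m=(m_1,\dots,m_r)\in\mathbb N_0^r\colon\sum_{\ell=1}^r\ell m_\ell=r\}$ and $|\boldsymbol m|=\sum_{\ell=1}^r m_\ell$. Vectors are column vectors; $\mathcal M_{m\times n}$ is the set of real $m\times n$ matrices; $\otimes$ is the Kronecker product, $\bigotimes_{\ell=1}^r$ is the Kronecker product taken in increasing order of $\ell$, and $\boldsymbol A^{\otimes m}$ is the $m$-fold Kronecker power ($\boldsymbol A^{\otimes1}=\boldsymbol A$, $\boldsymbol A^{\otimes0}=1$). $\operatorname{vec}$ stacks the columns of a matrix underneath each other. $\mathbf K_{m,n}\in\mathcal M_{mn\times mn}$ is the commutation matrix: $\mathbf K_{m,n}\operatorname{vec}\mathbf A=\operatorname{vec}(\mathbf A^\top)$ for all $\mathbf A\in\mathcal M_{m\times n}$. Vectorized derivatives: for a scalar function $f$ of $\boldsymbol x\in\mathbb R^n$, $\mathsf D^{\otimes r}f(\boldsymbol x)\in\mathbb R^{n^r}$ is the vector whose entry at position $1+\sum_{j=1}^r(i_j-1)n^{r-j}$ is $\frac{\partial^r f}{\partial x_{i_1}\cdots\partial x_{i_r}}(\boldsymbol x)$. For functions of a matrix variable $\mathbf X\in\mathcal M_{d\times d}$, derivatives are taken with respect to the vector variable $\operatorname{vec}\mathbf X\in\mathbb R^{d^2}$. Symmetrizer matrix: $\boldsymbol{\mathcal S}_{n,r}$ is the $n^r\times n^r$ matrix determined by $r!\,\boldsymbol{\mathcal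 S}_{n,r}(\boldsymbol v_1\otimes\cdots\otimes\boldsymbol v_r)=\sum_{\sigma\in\mathcal P_r}\boldsymbol v_{\sigma(1)}\otimes\cdots\otimes\boldsymbol v_{\sigma(r)}$ for all $\boldsymbol v_1,\dots,\boldsymbol v_r\in\mathbb R^n$, where $\mathcal P_r$ is the set of all permutations of $\{1,\dots,r\}$. *)

theory Defs
  imports
    Complex_Main
    "HOL-Library.FuncSet"
    "HOL-Combinatorics.Permutations"
    "HOL-Combinatorics.List_Permutation"
    "Jordan_Normal_Form.Determinant"
    "Jordan_Normal_Form.Gauss_Jordan_Elimination"
begin

text \<open>Indices of vectors and matrices start at 0.\<close>

definition vec_of_mat :: "real mat \<Rightarrow> real vec" where
  "vec_of_mat A = vec (dim_row A * dim_col A) (\<lambda>p. A $$ (p mod dim_row A, p div dim_row A))"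

definition mat_of_vec :: "nat \<Rightarrow> nat \<Rightarrow> real vec \<Rightarrow> real mat" where
  "mat_of_vec m n x = mat m n (\<lambda>(i, j). x $ (j * m + i))"

lemma vec_of_mat_carrier [simp]: "A \<in> carrier_mat m n \<Longrightarrow> vec_of_mat A \<in> carrier_vec (m * n)"
  by (auto simp: vec_of_mat_def)

lemma mat_of_vec_carrier [simp]: "mat_of_vec m n x \<in> carrier_mat m n"
  by (auto simp: mat_of_vec_def)

lemma col_major_less:
  fixes i j m n :: nat
  assumes "i < m" "j < n"
  shows "j * m + i < m * n"
proof -
  have "j * m + i < Suc j * m" using assms by simp
  also have "\<dots> \<le> n * m" using assms by (intro mult_le_mono) auto
  finally show ?thesis by (simp add: mult.commute)
qed

lemma mult_add_div_mod:
  fixes a b N :: nat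
  assumes "b < N"
  shows "(a * N + b) div N = a" "(a * N + b) mod N = b"
  using assms by (auto simp: div_mult_self3)

lemma mat_of_vec_of_mat: "A \<in> carrier_mat m n \<Longrightarrow> mat_of_vec m n (vec_of_mat A) = A"
  by (intro eq_matI) (auto simp: mat_of_vec_def vec_of_mat_def col_major_less)

lemma vec_of_mat_of_vec:
  assumes "x \<in> carrier_vec (m * n)"
  shows "vec_of_mat (mat_of_vec m n x) = x"
proof (intro eq_vecI)
  fix p assume "p < dim_vec x"
  then have p: "p < m * n" using assms by auto
  then have "m > 0" by (cases m) auto
  moreover have "p div m < n" using p by (simp add: less_mult_imp_div_less mult.commute)
  ultimately show "vec_of_mat (mat_of_vec m n x) $ p = x $ p"
    using p by (simp add: vec_of_mat_def mat_of_vec_def)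
qed (use assms in \<open>auto simp: vec_of_mat_def mat_of_vec_def\<close>)

definition kron_vec :: "real vec \<Rightarrow> real vec \<Rightarrow> real vec" where
  "kron_vec u v = vec (dim_vec u * dim_vec v) (\<lambda>p. u $ (p div dim_vec v) * v $ (p mod dim_vec v))"

definition kron_mat :: "real mat \<Rightarrow> real mat \<Rightarrow> real mat" where
  "kron_mat A B = mat (dim_row A * dim_row B) (dim_col A * dim_col B)
     (\<lambda>(i, j). A $$ (i div dim_row B, j div dim_col B) * B $$ (i mod dim_row B, j mod dim_col B))"

definition kron_vecs :: "real vec list \<Rightarrow> real vec" where
  "kron_vecs us = foldr kron_vec us (vec 1 (\<lambda>_. 1))"

definition kron_mats :: "real mat list \<Rightarrow> real mat" where
  "kron_mats As = foldr kron_mat As (1\<^sub>m 1)"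

definition kron_vec_pow :: "real vec \<Rightarrow> nat \<Rightarrow> real vec" where
  "kron_vec_pow u m = kron_vecs (replicate m u)"

definition kron_mat_pow :: "real mat \<Rightarrow> nat \<Rightarrow> real mat" where
  "kron_mat_pow A m = kron_mats (replicate m A)"

text \<open>
  Zero-based position of the multi-index \<open>ks = [k\<^sub>1, \<dots>, k\<^sub>r]\<close> (each \<open>k\<^sub>j < n\<close>) in a vector of
  length \<open>n ^ r\<close>.
\<close>
definition multi_pos :: "nat \<Rightarrow> nat list \<Rightarrow> nat" where
  "multi_pos n ks = (\<Sum>j<length ks. ks ! j * n ^ (length ks - 1 - j))"

text \<open>
  \<open>has_partial f [k\<^sub>1, \<dots>, k\<^sub>r] x a\<close>: the iterated partial derivative of \<open>f\<close> with respect to the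
  coordinates \<open>k\<^sub>1, \<dots>, k\<^sub>r\<close> exists at \<open>x\<close> and equals \<open>a\<close>. The witness \<open>g\<close> is the derivative with
  respect to the remaining coordinates, along the line through \<open>x\<close> in direction \<open>k\<^sub>1\<close>; it has to
  exist near \<open>x\<close> on that line.
\<close>
primrec has_partial :: "(real vec \<Rightarrow> real) \<Rightarrow> nat list \<Rightarrow> real vec \<Rightarrow> real \<Rightarrow> bool" where
  "has_partial f [] x a \<longleftrightarrow> f x = a"
| "has_partial f (k # ks) x a \<longleftrightarrow>
     (\<exists>g. (\<forall>\<^sub>F t in nhds 0. has_partial f ks (x + t \<cdot>\<^sub>v unit_vec (dim_vec x) k) (g t)) \<and>
          (g has_real_derivative a) (at 0))"

lemma has_partial_unique: "has_partial f ks x a \<Longrightarrow> has_partial f ks x b \<Longrightarrow> a = b"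
proof (induction ks arbitrary: x a b)
  case (Cons k ks)
  obtain g where g: "\<forall>\<^sub>F t in nhds 0. has_partial f ks (x + t \<cdot>\<^sub>v unit_vec (dim_vec x) k) (g t)"
    "(g has_real_derivative a) (at 0)" using Cons.prems by auto
  obtain h where h: "\<forall>\<^sub>F t in nhds 0. has_partial f ks (x + t \<cdot>\<^sub>v unit_vec (dim_vec x) k) (h t)"
    "(h has_real_derivative b) (at 0)" using Cons.prems by auto
  have "\<forall>\<^sub>F t in nhds 0. g t = h t"
    using g(1) h(1) by eventually_elim (rule Cons.IH)
  then have "(h has_real_derivative a) (at 0)"
    using g(2) DERIV_cong_ev[of 0 0 g h a a] by simp
  then show ?case using h(2) DERIV_unique by blast
qed simp

text \<open>
  \<open>v\<close> is the \<open>r\<close>-th vectorized derivative at \<open>x \<in> \<real>\<^sup>n\<close>, where \<open>n = dim_vec x\<close>; all partial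
  derivatives of order \<open>r\<close> are required to exist.
\<close>
definition has_vec_deriv :: "nat \<Rightarrow> (real vec \<Rightarrow> real) \<Rightarrow> real vec \<Rightarrow> real vec \<Rightarrow> bool" where
  "has_vec_deriv r f x v \<longleftrightarrow> v \<in> carrier_vec (dim_vec x ^ r) \<and>
     (\<forall>ks. length ks = r \<and> set ks \<subseteq> {..<dim_vec x} \<longrightarrow>
        has_partial f ks x (v $ multi_pos (dim_vec x) ks))"

definition has_mat_deriv :: "nat \<Rightarrow> (real mat \<Rightarrow> real) \<Rightarrow> real mat \<Rightarrow> real vec \<Rightarrow> bool" where
  "has_mat_deriv r f X v \<longleftrightarrow>
     has_vec_deriv r (\<lambda>x. f (mat_of_vec (dim_row X) (dim_col X) x)) (vec_of_mat X) v"

definition commutation_mat :: "nat \<Rightarrow> nat \<Rightarrow> real mat" where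
  "commutation_mat m n = (THE K. K \<in> carrier_mat (m * n) (m * n) \<and>
     (\<forall>A \<in> carrier_mat m n. K *\<^sub>v vec_of_mat A = vec_of_mat (transpose_mat A)))"

lemma mat_eqI_mult_vec:
  fixes A B :: "real mat"
  assumes "A \<in> carrier_mat m n" "B \<in> carrier_mat m n"
    and "\<And>j. j < n \<Longrightarrow> A *\<^sub>v unit_vec n j = B *\<^sub>v unit_vec n j"
  shows "A = B"
proof (rule eq_matI)
  fix i j assume ij: "i < dim_row B" "j < dim_col B"
  with assms have "i < m" "j < n" by auto
  then have *: "(A *\<^sub>v unit_vec n j) $ i = (B *\<^sub>v unit_vec n j) $ i" using assms by simp
  have "(A *\<^sub>v unit_vec n j) $ i = A $$ (i, j)" "(B *\<^sub>v unit_vec n j) $ i = B $$ (i, j)"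
    using assms(1,2) \<open>i < m\<close> \<open>j < n\<close> by (auto simp: scalar_prod_right_unit)
  with * show "A $$ (i, j) = B $$ (i, j)" by simp
qed (use assms in auto)

lemma mult_selection_mat:
  assumes "x \<in> carrier_vec n" "\<And>p. p < m \<Longrightarrow> s p < n" "p < m"
  shows "(mat m n (\<lambda>(p, q). if q = s p then 1 else (0 :: real)) *\<^sub>v x) $ p = x $ s p"
proof -
  have "(mat m n (\<lambda>(p, q). if q = s p then 1 else (0 :: real)) *\<^sub>v x) $ p
      = (\<Sum>q<n. (if q = s p then 1 else 0) * x $ q)"
    using assms by (auto simp: scalar_prod_def atLeast0LessThan intro!: sum.cong)
  also have "\<dots> = (\<Sum>q<n. if q = s p then x $ q else 0)"
    by (intro sum.cong) auto
  also have "\<dots> = x $ s p" using assms by simp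
  finally show ?thesis .
qed

lemma commutation_mat_ex1:
  "\<exists>!K. K \<in> carrier_mat (m * n) (m * n) \<and>
     (\<forall>A \<in> carrier_mat m n. K *\<^sub>v vec_of_mat A = vec_of_mat (transpose_mat A))"
proof (rule ex_ex1I)
  let ?s = "\<lambda>p. (p mod n) * m + p div n"
  let ?K = "mat (m * n) (m * n) (\<lambda>(p, q). if q = ?s p then 1 else (0 :: real))"
  have s: "p mod n < n" "p div n < m" "?s p < m * n" if "p < m * n" for p
  proof -
    show "p mod n < n" using that by (cases n) auto
    moreover show "p div n < m" using that by (simp add: less_mult_imp_div_less)
    ultimately show "?s p < m * n" by (intro col_major_less)
  qed
  have "?K *\<^sub>v vec_of_mat A = vec_of_mat (transpose_mat A)" if A: "A \<in> carrier_mat m n" for A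
  proof (intro eq_vecI)
    fix p assume "p < dim_vec (vec_of_mat (transpose_mat A))"
    then have p: "p < m * n" using A by (auto simp: vec_of_mat_def mult.commute)
    have "(?K *\<^sub>v vec_of_mat A) $ p = vec_of_mat A $ ?s p"
      using mult_selection_mat[of "vec_of_mat A" "m * n" "m * n" ?s p] s p A by simp
    also have "\<dots> = A $$ (p div n, p mod n)"
      using s(3)[OF p] A s(1,2)[OF p] by (auto simp: vec_of_mat_def)
    also have "\<dots> = vec_of_mat (transpose_mat A) $ p"
      using s[OF p] p A by (auto simp: vec_of_mat_def mult.commute)
    finally show "(?K *\<^sub>v vec_of_mat A) $ p = vec_of_mat (transpose_mat A) $ p" .
  qed (use A in \<open>auto simp: vec_of_mat_def mult.commute\<close>)
  then show "\<exists>K. K \<in> carrier_mat (m * n) (m * n) \<and>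
     (\<forall>A \<in> carrier_mat m n. K *\<^sub>v vec_of_mat A = vec_of_mat (transpose_mat A))"
    by (intro exI[of _ ?K]) auto
next
  fix K L
  assume K: "K \<in> carrier_mat (m * n) (m * n) \<and>
     (\<forall>A \<in> carrier_mat m n. K *\<^sub>v vec_of_mat A = vec_of_mat (transpose_mat A))"
    and L: "L \<in> carrier_mat (m * n) (m * n) \<and>
     (\<forall>A \<in> carrier_mat m n. L *\<^sub>v vec_of_mat A = vec_of_mat (transpose_mat A))"
  show "K = L"
  proof (rule mat_eqI_mult_vec)
    fix j
    have "unit_vec (m * n) j = vec_of_mat (mat_of_vec m n (unit_vec (m * n) j))"
      by (simp add: vec_of_mat_of_vec)
    then show "K *\<^sub>v unit_vec (m * n) j = L *\<^sub>v unit_vec (m * n) j"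
      using K L mat_of_vec_carrier by metis
  qed (use K L in auto)
qed

definition symmetrizer_mat :: "nat \<Rightarrow> nat \<Rightarrow> real mat" where
  "symmetrizer_mat n r = (THE S. S \<in> carrier_mat (n ^ r) (n ^ r) \<and>
     (\<forall>vs. length vs = r \<and> set vs \<subseteq> carrier_vec n \<longrightarrow>
        fact r \<cdot>\<^sub>v (S *\<^sub>v kron_vecs vs) =
          vec (n ^ r) (\<lambda>p. \<Sum>\<sigma> | \<sigma> permutes {..<r}. kron_vecs (permute_list \<sigma> vs) $ p)))"

lemma multi_pos_Nil [simp]: "multi_pos n [] = 0"
  by (simp add: multi_pos_def)

lemma multi_pos_Cons [simp]: "multi_pos n (k # ks) = k * n ^ length ks + multi_pos n ks"
  by (simp add: multi_pos_def sum.lessThan_Suc_shift del: sum.lessThan_Suc)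

lemma multi_pos_less: "set ks \<subseteq> {..<n} \<Longrightarrow> multi_pos n ks < n ^ length ks"
proof (induction ks)
  case (Cons k ks)
  then have "multi_pos n ks < n ^ length ks" "k < n" by auto
  then show ?case using col_major_less[of "multi_pos n ks" "n ^ length ks" k n]
    by (simp add: mult.commute)
qed simp

lemma multi_pos_surj:
  "p < n ^ r \<Longrightarrow> \<exists>ks. length ks = r \<and> set ks \<subseteq> {..<n} \<and> multi_pos n ks = p"
proof (induction r arbitrary: p)
  case (Suc r)
  then have "n > 0" by (cases n) auto
  then have "p mod n ^ r < n ^ r" by simp
  then obtain ks where ks: "length ks = r" "set ks \<subseteq> {..<n}" "multi_pos n ks = p mod n ^ r"
    using Suc.IH by blast
  have "p div n ^ r < n" using Suc.prems by (simp add: less_mult_imp_div_less)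
  moreover have "p div n ^ r * n ^ r + p mod n ^ r = p" by (rule div_mult_mod_eq)
  ultimately show ?case using ks by (intro exI[of _ "(p div n ^ r) # ks"]) auto
qed simp

lemma multi_pos_inj:
  "length ks = length ls \<Longrightarrow> set ks \<subseteq> {..<n} \<Longrightarrow> set ls \<subseteq> {..<n} \<Longrightarrow>
   multi_pos n ks = multi_pos n ls \<Longrightarrow> ks = ls"
proof (induction ks ls rule: list_induct2)
  case (Cons k ks l ls)
  let ?N = "n ^ length ls"
  have less: "multi_pos n ks < ?N" "multi_pos n ls < ?N"
    using multi_pos_less[of ks n] multi_pos_less[of ls n] Cons by auto
  have eq: "k * ?N + multi_pos n ks = l * ?N + multi_pos n ls" using Cons by simp
  have "(k * ?N + multi_pos n ks) div ?N = k" "(l * ?N + multi_pos n ls) div ?N = l"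
    using less by (simp_all only: mult_add_div_mod)
  with eq have "k = l" by simp
  with eq Cons show ?case by simp
qed simp

lemma kron_vecs_Cons: "kron_vecs (v # vs) = kron_vec v (kron_vecs vs)"
  by (simp add: kron_vecs_def)

lemma kron_vecs_carrier: "set vs \<subseteq> carrier_vec n \<Longrightarrow> kron_vecs vs \<in> carrier_vec (n ^ length vs)"
  by (induction vs) (auto simp: kron_vecs_def kron_vec_def)

lemma kron_vecs_nth:
  "length ks = length vs \<Longrightarrow> set vs \<subseteq> carrier_vec n \<Longrightarrow> set ks \<subseteq> {..<n} \<Longrightarrow>
   kron_vecs vs $ multi_pos n ks = (\<Prod>j<length vs. vs ! j $ (ks ! j))"
proof (induction ks vs rule: list_induct2)
  case Nil
  then show ?case by (simp add: kron_vecs_def)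
next
  case (Cons k ks v vs)
  let ?N = "n ^ length vs"
  have d: "dim_vec (kron_vecs vs) = ?N" "dim_vec v = n"
    using kron_vecs_carrier[of vs n] Cons by auto
  have less: "multi_pos n ks < ?N" "k < n" using multi_pos_less[of ks n] Cons by auto
  then have "k * ?N + multi_pos n ks < n * ?N"
    using col_major_less[of "multi_pos n ks" ?N k n] by (simp add: mult.commute)
  then show ?case
    using Cons less by (simp add: d mult_add_div_mod kron_vecs_Cons kron_vec_def prod.lessThan_Suc_shift del: prod.lessThan_Suc)
qed

lemma kron_vecs_unit:
  assumes "set ks \<subseteq> {..<n}"
  shows "kron_vecs (map (unit_vec n) ks) = unit_vec (n ^ length ks) (multi_pos n ks)"
proof (rule eq_vecI)
  have c: "set (map (unit_vec n) ks) \<subseteq> (carrier_vec n :: real vec set)" by auto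
  show "dim_vec (kron_vecs (map (unit_vec n) ks)) = dim_vec (unit_vec (n ^ length ks) (multi_pos n ks))"
    using kron_vecs_carrier[OF c] by simp
  fix p assume "p < dim_vec (unit_vec (n ^ length ks) (multi_pos n ks))"
  then have p: "p < n ^ length ks" by simp
  then obtain ls where ls: "length ls = length ks" "set ls \<subseteq> {..<n}" "multi_pos n ls = p"
    using multi_pos_surj by blast
  have "kron_vecs (map (unit_vec n) ks) $ p = (\<Prod>j<length ks. unit_vec n (ks ! j) $ (ls ! j))"
    using kron_vecs_nth[of ls "map (unit_vec n) ks" n] ls c by simp
  also have "\<dots> = (\<Prod>j<length ks. if ls ! j = ks ! j then 1 else (0 :: real))"
  proof (intro prod.cong refl)
    fix j assume "j \<in> {..<length ks}"
    then have "ls ! j < n" "ks ! j < n" using ls assms nth_mem by (metis lessThan_iff subsetD)+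
    then show "unit_vec n (ks ! j) $ (ls ! j) = (if ls ! j = ks ! j then 1 else (0 :: real))"
      by simp
  qed
  also have "\<dots> = (if ls = ks then 1 else 0)"
    using ls(1) by (auto simp: list_eq_iff_nth_eq)
  also have "\<dots> = unit_vec (n ^ length ks) (multi_pos n ks) $ p"
    using multi_pos_inj[of ls ks n] multi_pos_less[OF assms] p ls assms by auto
  finally show "kron_vecs (map (unit_vec n) ks) $ p = unit_vec (n ^ length ks) (multi_pos n ks) $ p" .
qed

lemma kron_vecs_permute:
  assumes "set vs \<subseteq> carrier_vec n" "set ks \<subseteq> {..<n}" "length ks = length vs"
    and "\<sigma> permutes {..<length vs}"
  shows "kron_vecs (permute_list \<sigma> vs) $ multi_pos n ks =
         kron_vecs vs $ multi_pos n (permute_list (inv_into UNIV \<sigma>) ks)"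
proof -
  let ?r = "length vs"
  have inv: "inv_into UNIV \<sigma> permutes {..<?r}" using assms(4) by (rule permutes_inv)
  have "kron_vecs (permute_list \<sigma> vs) $ multi_pos n ks = (\<Prod>j<?r. (vs ! \<sigma> j) $ (ks ! j))"
    using kron_vecs_nth[of ks "permute_list \<sigma> vs" n] assms by (simp add: permute_list_nth)
  also have "\<dots> = (\<Prod>j<?r. (vs ! \<sigma> (inv_into UNIV \<sigma> j)) $ (ks ! inv_into UNIV \<sigma> j))"
    using prod.permute[OF inv, of "\<lambda>j. (vs ! \<sigma> j) $ (ks ! j)"] by (simp add: o_def)
  also have "\<dots> = (\<Prod>j<?r. (vs ! j) $ (permute_list (inv_into UNIV \<sigma>) ks ! j))"
    using assms inv by (intro prod.cong) (auto simp: permute_list_nth permutes_inverses)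
  also have "\<dots> = kron_vecs vs $ multi_pos n (permute_list (inv_into UNIV \<sigma>) ks)"
    using kron_vecs_nth[of "permute_list (inv_into UNIV \<sigma>) ks" vs n] assms inv by simp
  finally show ?thesis .
qed

lemma symmetrizer_mat_ex1:
  "\<exists>!S. S \<in> carrier_mat (n ^ r) (n ^ r) \<and>
     (\<forall>vs. length vs = r \<and> set vs \<subseteq> carrier_vec n \<longrightarrow>
        fact r \<cdot>\<^sub>v (S *\<^sub>v kron_vecs vs) =
          vec (n ^ r) (\<lambda>p. \<Sum>\<sigma> | \<sigma> permutes {..<r}. kron_vecs (permute_list \<sigma> vs) $ p))"
proof (rule ex_ex1I)
  let ?N = "n ^ r"
  define dg where "dg p = (SOME ks. length ks = r \<and> set ks \<subseteq> {..<n} \<and> multi_pos n ks = p)" for p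
  have dg: "length (dg p) = r" "set (dg p) \<subseteq> {..<n}" "multi_pos n (dg p) = p" if "p < ?N" for p
    using someI_ex[OF multi_pos_surj[OF that]] unfolding dg_def by auto
  let ?s = "\<lambda>\<sigma> p. multi_pos n (permute_list (inv_into UNIV \<sigma>) (dg p))"
  let ?S = "mat ?N ?N (\<lambda>(p, q). (\<Sum>\<sigma> | \<sigma> permutes {..<r}. if q = ?s \<sigma> p then 1 else 0) / fact r)"
  have s: "?s \<sigma> p < ?N" if "\<sigma> permutes {..<r}" "p < ?N" for \<sigma> p
  proof -
    have "inv_into UNIV \<sigma> permutes {..<length (dg p)}" using that dg permutes_inv by metis
    then show ?thesis
      using multi_pos_less[of "permute_list (inv_into UNIV \<sigma>) (dg p)" n] dg[OF that(2)] by simp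
  qed
  have "fact r \<cdot>\<^sub>v (?S *\<^sub>v kron_vecs vs) =
      vec ?N (\<lambda>p. \<Sum>\<sigma> | \<sigma> permutes {..<r}. kron_vecs (permute_list \<sigma> vs) $ p)"
    if vs: "length vs = r" "set vs \<subseteq> carrier_vec n" for vs
  proof (rule eq_vecI)
    fix p assume "p < dim_vec (vec ?N
      (\<lambda>p. \<Sum>\<sigma> | \<sigma> permutes {..<r}. kron_vecs (permute_list \<sigma> vs) $ p))"
    then have p: "p < ?N" by simp
    have d: "dim_vec (kron_vecs vs) = ?N" using kron_vecs_carrier[OF vs(2)] vs by auto
    have "(fact r \<cdot>\<^sub>v (?S *\<^sub>v kron_vecs vs)) $ p =
        fact r * (\<Sum>q<?N. (\<Sum>\<sigma> | \<sigma> permutes {..<r}. if q = ?s \<sigma> p then 1 else 0) / fact r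
          * kron_vecs vs $ q)"
      using p d by (auto simp: scalar_prod_def atLeast0LessThan intro!: sum.cong)
    also have "\<dots> = (\<Sum>q<?N. \<Sum>\<sigma> | \<sigma> permutes {..<r}. (if q = ?s \<sigma> p then kron_vecs vs $ q else 0))"
      unfolding sum_distrib_left
      by (intro sum.cong refl) (simp add: sum_distrib_right if_distrib[of "\<lambda>x. x * _"] cong: if_cong)
    also have "\<dots> = (\<Sum>\<sigma> | \<sigma> permutes {..<r}. \<Sum>q<?N. (if q = ?s \<sigma> p then kron_vecs vs $ q else 0))"
      by (rule sum.swap)
    also have "\<dots> = (\<Sum>\<sigma> | \<sigma> permutes {..<r}. kron_vecs (permute_list \<sigma> vs) $ p)"
    proof (intro sum.cong refl)
      fix \<sigma> assume "\<sigma> \<in> {\<sigma>. \<sigma> permutes {..<r}}"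
      then have \<sigma>: "\<sigma> permutes {..<r}" by simp
      then show "(\<Sum>q<?N. if q = ?s \<sigma> p then kron_vecs vs $ q else 0)
          = kron_vecs (permute_list \<sigma> vs) $ p"
        using s[OF \<sigma> p] kron_vecs_permute[of vs n "dg p" \<sigma>] vs dg[OF p] by simp
    qed
    also have "\<dots> = vec ?N (\<lambda>p. \<Sum>\<sigma> | \<sigma> permutes {..<r}. kron_vecs (permute_list \<sigma> vs) $ p) $ p"
      using p by simp
    finally show "(fact r \<cdot>\<^sub>v (?S *\<^sub>v kron_vecs vs)) $ p =
      vec ?N (\<lambda>p. \<Sum>\<sigma> | \<sigma> permutes {..<r}. kron_vecs (permute_list \<sigma> vs) $ p) $ p" .
  qed simp
  then show "\<exists>S. S \<in> carrier_mat ?N ?N \<and>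
     (\<forall>vs. length vs = r \<and> set vs \<subseteq> carrier_vec n \<longrightarrow>
        fact r \<cdot>\<^sub>v (S *\<^sub>v kron_vecs vs) =
          vec ?N (\<lambda>p. \<Sum>\<sigma> | \<sigma> permutes {..<r}. kron_vecs (permute_list \<sigma> vs) $ p))"
    by (intro exI[of _ ?S]) auto
next
  let ?N = "n ^ r"
  let ?P = "\<lambda>S. S \<in> carrier_mat ?N ?N \<and>
     (\<forall>vs. length vs = r \<and> set vs \<subseteq> carrier_vec n \<longrightarrow>
        fact r \<cdot>\<^sub>v (S *\<^sub>v kron_vecs vs) =
          vec ?N (\<lambda>p. \<Sum>\<sigma> | \<sigma> permutes {..<r}. kron_vecs (permute_list \<sigma> vs) $ p))"
  fix S T :: "real mat" assume S: "?P S" and T: "?P T"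
  show "S = T"
  proof (rule mat_eqI_mult_vec)
    fix q assume "q < ?N"
    then obtain ks where ks: "length ks = r" "set ks \<subseteq> {..<n}" "multi_pos n ks = q"
      using multi_pos_surj by blast
    have u: "unit_vec ?N q = kron_vecs (map (unit_vec n) ks)"
      using kron_vecs_unit[OF ks(2)] ks by simp
    have "length (map (unit_vec n) ks) = r \<and> set (map (unit_vec n) ks) \<subseteq> (carrier_vec n :: real vec set)"
      using ks by auto
    then have "fact r \<cdot>\<^sub>v (S *\<^sub>v unit_vec ?N q) = fact r \<cdot>\<^sub>v (T *\<^sub>v unit_vec ?N q)"
      unfolding u using S T by metis
    then have "(1 / fact r) \<cdot>\<^sub>v (fact r \<cdot>\<^sub>v (S *\<^sub>v unit_vec ?N q)) =
        (1 / fact r) \<cdot>\<^sub>v (fact r \<cdot>\<^sub>v (T *\<^sub>v unit_vec ?N q))" by simp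
    then show "S *\<^sub>v unit_vec ?N q = T *\<^sub>v unit_vec ?N q"
      by (simp add: smult_smult_assoc)
  qed (use S T in auto)
qed

text \<open>Tuples \<open>(m\<^sub>1, \<dots>, m\<^sub>r)\<close> are extensional functions on \<open>{1..r}\<close>.\<close>
definition weight_tuples :: "nat \<Rightarrow> (nat \<Rightarrow> nat) set" where
  "weight_tuples r = {m \<in> {1..r} \<rightarrow>\<^sub>E UNIV. (\<Sum>l=1..r. l * m l) = r}"

lemma finite_weight_tuples: "finite (weight_tuples r)"
proof (rule finite_subset)
  show "weight_tuples r \<subseteq> {1..r} \<rightarrow>\<^sub>E {..r}"
  proof
    fix m assume m: "m \<in> weight_tuples r"
    have "m l \<le> r" if l: "l \<in> {1..r}" for l
    proof -
      have "m l \<le> l * m l" using l by simp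
      also have "\<dots> \<le> (\<Sum>l=1..r. l * m l)" by (rule member_le_sum) (use l in auto)
      finally show ?thesis using m by (simp add: weight_tuples_def)
    qed
    then show "m \<in> {1..r} \<rightarrow>\<^sub>E {..r}" using m by (auto simp: weight_tuples_def PiE_iff)
  qed
qed (auto intro: finite_PiE)

text \<open>The sum of matrices over \<open>weight_tuples r\<close> is taken entrywise.\<close>
definition Xi_mat :: "nat \<Rightarrow> nat \<Rightarrow> real mat" where
  "Xi_mat d r = mat (d ^ (2 * r)) (d ^ (2 * r)) (\<lambda>(i, j).
     \<Sum>m\<in>weight_tuples r.
       (-1) ^ (r - (\<Sum>l=1..r. m l)) * (fact r / (\<Prod>l=1..r. fact (m l) * real l ^ m l)) *
       kron_mats (map (\<lambda>l. kron_mat_pow (commutation_mat d (d ^ (2 * l - 1))) (m l)) [1..<Suc r])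
         $$ (i, j))"

end

theory Submission
  imports Defs "HOL-Combinatorics.Multiset_Permutations"
begin

text \<open>
  Let \<open>Y\<close> be the inverse of \<open>X\<close>. The coordinate \<open>u\<close> of the vectorized matrix is the entry in row
  \<open>u mod d\<close> and column \<open>u div d\<close>. For two coordinates put \<open>w u v = Y (v div d, u mod d)\<close>. Then the
  whole calculus consists of two rules: the derivative of \<open>log |X|\<close> in coordinate \<open>k\<close> is \<open>w k k\<close>,
  and the derivative of \<open>w u v\<close> is \<open>- w u k * w k v\<close>. Both come from the explicit formulas for the
  determinant and the inverse when a single entry changes (\<open>det_add_entry\<close>,
  \<open>mat_inverse_add_entry\<close>).

  Read \<open>w u v\<close> as the weight of an edge. By the second rule, differentiating the weight of a walk
  inserts \<open>k\<close> into each of its steps, with a minus sign. So the partial derivative of \<open>log |X|\<close> along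
  \<open>r\<close> coordinates is \<open>(-1) ^ (r - 1)\<close> times the sum of the weights of the closed walks through the
  \<open>(r - 1)!\<close> cyclic arrangements of these coordinates, that is, \<open>(-1) ^ (r - 1) / r\<close> times the sum
  over all their arrangements (\<open>cumulant\<close>, \<open>has_partial_ln_det\<close>). On the matrix side, the commutation
  matrix moves the leading base-\<open>d\<close> digit of a position to the end, which turns the entries of
  \<open>(vec Y)\<close> to the Kronecker power \<open>r\<close> into weights of closed walks
  (\<open>commutation_mat_kron_vec_pow\<close>), and the symmetrizer averages over all arrangements.

  For the determinant, write \<open>|X| = exp (log |X|)\<close>. Functions of finite sets form an algebra under
  the convolution \<open>F * G\<close> with \<open>(F * G) S\<close> the sum of \<open>F T * G (S - T)\<close> over the subsets \<open>T\<close> of \<open>S\<close>,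
  and the partial derivative of \<open>|X|\<close> along the elements of \<open>S\<close> is \<open>|X|\<close> times the value at \<open>S\<close> of the
  exponential of the cumulants in this algebra. To see this, compare two operations: adjoining \<open>k\<close> to
  the argument \<open>S\<close>, and differentiating in coordinate \<open>k\<close>. Both are derivations, and they agree on the
  cumulants of nonempty sets, so on an exponential \<open>E\<close> of the cumulants their difference is
  multiplication with the remaining value \<open>w k k\<close>. Hence \<open>w k k * E S\<close> plus the derivative of \<open>E S\<close>
  is \<open>E (insert k S)\<close>, which is the product rule for \<open>|X| * E S\<close> (\<open>has_derivative_moment\<close>,
  \<open>has_partial_det\<close>).

  The exponential is taken separately for each block size \<open>l\<close>. Expanding this product of exponential
  series gives one term for each tuple \<open>m\<close>: the denominators \<open>m\<^sub>l!\<close> come from the series, the signs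
  and the powers of \<open>l\<close> from the cumulants (\<open>moment_eq_sum_weight_tuples\<close>). The number of permutations
  of a given cycle type is never counted. The mixed product rule for Kronecker products shows that
  the summands of \<open>Xi_mat\<close> produce the same products of closed walks (\<open>acts_by_blocks_kron_mats\<close>).
\<close>

section \<open>Closed walks and their derivatives\<close>

primrec walk :: "('a \<Rightarrow> 'a \<Rightarrow> real) \<Rightarrow> 'a \<Rightarrow> 'a list \<Rightarrow> 'a \<Rightarrow> real" where
  "walk w u [] v = w u v"
| "walk w u (x # xs) v = w u x * walk w x xs v"

text \<open>
  The value at the empty list is chosen so that relabelling commutes with \<open>closed_walk\<close> without
  a side condition.
\<close>
definition closed_walk :: "('a \<Rightarrow> 'a \<Rightarrow> real) \<Rightarrow> 'a list \<Rightarrow> real" where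
  "closed_walk w xs = (case xs of [] \<Rightarrow> 1 | x # ys \<Rightarrow> walk w x ys x)"

definition walk_sum :: "('a \<Rightarrow> 'a \<Rightarrow> real) \<Rightarrow> 'a set \<Rightarrow> 'a \<Rightarrow> 'a \<Rightarrow> real" where
  "walk_sum w S u v = (\<Sum>xs\<in>permutations_of_set S. walk w u xs v)"

definition cycle_sum :: "('a \<Rightarrow> 'a \<Rightarrow> real) \<Rightarrow> 'a set \<Rightarrow> real" where
  "cycle_sum w S = (\<Sum>xs\<in>permutations_of_set S. closed_walk w xs)"

text \<open>
  The partial derivative of \<open>log |X|\<close> along the elements of \<open>S\<close>. The sum runs over all arrangements of
  \<open>S\<close>, not only over the cyclic ones, hence the denominator. Division by zero makes the value at the
  empty set 0, as it should be for the exponential.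
\<close>
definition cumulant :: "('a \<Rightarrow> 'a \<Rightarrow> real) \<Rightarrow> 'a set \<Rightarrow> real" where
  "cumulant w S = (-1) ^ (card S - 1) / card S * cycle_sum w S"

lemma sum_permutations_of_set_Cons:
  assumes "S \<noteq> {}"
  shows "(\<Sum>xs\<in>permutations_of_set S. f xs) = (\<Sum>x\<in>S. \<Sum>xs\<in>permutations_of_set (S - {x}). f (x # xs))"
proof (cases "finite S")
  case True
  have "(\<Sum>xs\<in>permutations_of_set S. f xs)
      = (\<Sum>x\<in>S. \<Sum>xs\<in>(\<lambda>xs. x # xs) ` permutations_of_set (S - {x}). f xs)"
    unfolding permutations_of_set_nonempty[OF assms] using True
    by (intro sum.UNION_disjoint) auto
  then show ?thesis by (simp add: sum.reindex inj_on_def)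
qed (simp add: permutations_of_set_infinite)

lemma walk_sum_empty [simp]: "walk_sum w {} u v = w u v"
  by (simp add: walk_sum_def)

lemma walk_sum_rec:
  assumes "S \<noteq> {}"
  shows "walk_sum w S u v = (\<Sum>x\<in>S. w u x * walk_sum w (S - {x}) x v)"
  using assms by (simp add: walk_sum_def sum_permutations_of_set_Cons sum_distrib_left)

lemma walk_snoc: "walk w u (xs @ [y]) v = walk w u xs y * w y v"
  by (induction xs arbitrary: u) auto

lemma closed_walk_rotate1: "closed_walk w (rotate1 xs) = closed_walk w xs"
proof (cases xs)
  case (Cons x ys)
  then show ?thesis
    by (cases ys) (simp_all add: closed_walk_def walk_snoc mult.commute)
qed simp

lemma closed_walk_rotate: "closed_walk w (rotate n xs) = closed_walk w xs"
  by (induction n) (simp_all add: closed_walk_rotate1)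

lemma rotate_permutations_of_set: "rotate n ` permutations_of_set S = permutations_of_set S"
proof
  show *: "rotate n ` permutations_of_set S \<subseteq> permutations_of_set S" for n
    by (auto simp: permutations_of_set_def)
  show "permutations_of_set S \<subseteq> rotate n ` permutations_of_set S"
  proof
    fix xs assume xs: "xs \<in> permutations_of_set S"
    let ?m = "n * (length xs - 1)"
    have "rotate n (rotate ?m xs) = rotate (n + ?m) xs" by (simp add: rotate_rotate)
    also have "\<dots> = rotate (n * length xs) xs"
      by (cases "length xs") (simp_all add: algebra_simps)
    also have "\<dots> = xs" by (subst rotate_conv_mod) simp
    finally have "rotate n (rotate ?m xs) = xs" .
    moreover have "rotate ?m xs \<in> permutations_of_set S" using *[of ?m] xs by blast
    ultimately show "xs \<in> rotate n ` permutations_of_set S" by (metis imageI)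
  qed
qed

text \<open>
  A closed walk can be rotated so that it starts at \<open>k\<close>. Sorting the arrangements by the place of
  \<open>k\<close> therefore gives \<open>card (insert k S)\<close> equal parts.
\<close>
lemma cycle_sum_insert:
  assumes "finite S" "k \<notin> S"
  shows "cycle_sum w (insert k S) = Suc (card S) * walk_sum w S k k"
proof -
  let ?T = "insert k S"
  let ?P = "permutations_of_set ?T"
  let ?n = "Suc (card S)"
  have len: "length xs = ?n" if "xs \<in> ?P" for xs
    using that assms length_finite_permutations_of_set by fastforce
  have one: "(\<Sum>i<?n. if xs ! i = k then closed_walk w xs else 0) = closed_walk w xs"
    if xs: "xs \<in> ?P" for xs
  proof -
    have "k \<in> set xs" "distinct xs" using permutations_of_setD[OF xs] by auto
    then obtain j where j: "j < ?n" "xs ! j = k" using len[OF xs] by (metis in_set_conv_nth)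
    have "(\<Sum>i<?n. if xs ! i = k then closed_walk w xs else 0)
        = (\<Sum>i<?n. if i = j then closed_walk w xs else 0)"
      using \<open>distinct xs\<close> j len[OF xs]
      by (intro sum.cong refl) (auto simp: nth_eq_iff_index_eq)
    also have "\<dots> = closed_walk w xs" using j by simp
    finally show ?thesis .
  qed
  have "cycle_sum w ?T = (\<Sum>xs\<in>?P. \<Sum>i<?n. if xs ! i = k then closed_walk w xs else 0)"
    unfolding cycle_sum_def by (intro sum.cong refl one[symmetric])
  also have "\<dots> = (\<Sum>i<?n. \<Sum>xs\<in>?P. if xs ! i = k then closed_walk w xs else 0)"
    by (rule sum.swap)
  also have "\<dots> = (\<Sum>i<?n. walk_sum w S k k)"
  proof (intro sum.cong refl)
    fix i assume i: "i \<in> {..<?n}"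
    have inj: "inj_on (rotate i) ?P"
      by (intro finite_surj_inj) (auto simp: rotate_permutations_of_set)
    have "(\<Sum>xs\<in>?P. if hd xs = k then closed_walk w xs else 0)
        = (\<Sum>xs\<in>rotate i ` ?P. if hd xs = k then closed_walk w xs else 0)"
      by (simp add: rotate_permutations_of_set)
    also have "\<dots> = (\<Sum>xs\<in>?P. if hd (rotate i xs) = k then closed_walk w xs else 0)"
      by (subst sum.reindex[OF inj]) (simp add: closed_walk_rotate o_def cong: if_cong)
    also have "\<dots> = (\<Sum>xs\<in>?P. if xs ! i = k then closed_walk w xs else 0)"
    proof (intro sum.cong refl)
      fix xs assume "xs \<in> ?P"
      then have "length xs = ?n" by (rule len)
      then have "hd (rotate i xs) = xs ! i"
        using i hd_rotate_conv_nth[of xs i] by fastforce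
      then show "(if hd (rotate i xs) = k then closed_walk w xs else 0)
        = (if xs ! i = k then closed_walk w xs else 0)" by simp
    qed
    finally have "(\<Sum>xs\<in>?P. if xs ! i = k then closed_walk w xs else 0)
        = (\<Sum>xs\<in>?P. if hd xs = k then closed_walk w xs else 0)" by simp
    also have "\<dots> = (\<Sum>x\<in>?T. if x = k then walk_sum w (?T - {k}) k k else 0)"
      by (subst sum_permutations_of_set_Cons)
        (auto simp: walk_sum_def closed_walk_def intro!: sum.cong)
    also have "\<dots> = walk_sum w S k k" using assms by simp
    finally show "(\<Sum>xs\<in>?P. if xs ! i = k then closed_walk w xs else 0) = walk_sum w S k k" .
  qed
  finally show ?thesis by simp
qed

lemma cumulant_insert:
  assumes "finite S" "k \<notin> S"
  shows "cumulant w (insert k S) = (-1) ^ card S * walk_sum w S k k"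
  using assms by (simp add: cumulant_def cycle_sum_insert)

lemma cumulant_singleton [simp]: "cumulant w {k} = w k k"
  using cumulant_insert[of "{}" k w] by simp

text \<open>
  By the rule for edges, the first step splits into the two ways in which an arrangement of
  \<open>insert k S\<close> can begin: with \<open>k\<close>, or with an element of \<open>S\<close>. The latter is the induction
  hypothesis.
\<close>
lemma has_derivative_walk_sum:
  fixes w :: "real \<Rightarrow> 'a \<Rightarrow> 'a \<Rightarrow> real"
  assumes w: "\<And>u v. ((\<lambda>t. w t u v) has_real_derivative - w 0 u k * w 0 k v) (at 0)"
    and "finite S" "k \<notin> S"
  shows "((\<lambda>t. walk_sum (w t) S u v) has_real_derivative - walk_sum (w 0) (insert k S) u v) (at 0)"
  using assms(2,3)
proof (induction S arbitrary: u rule: finite_remove_induct)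
  case empty
  then show ?case using w[of u v] by (simp add: walk_sum_rec)
next
  case (remove S)
  have ins: "insert k S - {x} = insert k (S - {x})" if "x \<in> S" for x
    using remove.prems that by auto
  have IH: "((\<lambda>t. walk_sum (w t) (S - {x}) x v) has_real_derivative
      - walk_sum (w 0) (insert k (S - {x})) x v) (at 0)" if "x \<in> S" for x
    using remove that by auto
  have "((\<lambda>t. \<Sum>x\<in>S. w t u x * walk_sum (w t) (S - {x}) x v) has_real_derivative
      (\<Sum>x\<in>S. w 0 u x * - walk_sum (w 0) (insert k (S - {x})) x v
            + - w 0 u k * w 0 k x * walk_sum (w 0) (S - {x}) x v)) (at 0)"
    by (intro DERIV_sum DERIV_mult' w IH)
  also have "(\<Sum>x\<in>S. w 0 u x * - walk_sum (w 0) (insert k (S - {x})) x v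
            + - w 0 u k * w 0 k x * walk_sum (w 0) (S - {x}) x v)
      = - (w 0 u k * (\<Sum>x\<in>S. w 0 k x * walk_sum (w 0) (S - {x}) x v)
          + (\<Sum>x\<in>S. w 0 u x * walk_sum (w 0) (insert k (S - {x})) x v))"
    by (simp add: sum.distrib sum_negf sum_subtractf sum_distrib_left mult.assoc)
  also have "\<dots> = - walk_sum (w 0) (insert k S) u v"
    using remove ins by (simp add: walk_sum_rec[of "insert k S"] walk_sum_rec[of S])
  finally show ?case using remove by (simp add: walk_sum_rec[of S])
qed

text \<open>
  Write every cycle from a fixed element of \<open>S\<close>. Differentiating inserts \<open>k\<close> at each place after it,
  which gives each cycle through \<open>insert k S\<close> exactly once.
\<close>
lemma has_derivative_cumulant:
  fixes w :: "real \<Rightarrow> 'a \<Rightarrow> 'a \<Rightarrow> real"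
  assumes w: "\<And>u v. ((\<lambda>t. w t u v) has_real_derivative - w 0 u k * w 0 k v) (at 0)"
    and S: "finite S" "k \<notin> S" "S \<noteq> {}"
  shows "((\<lambda>t. cumulant (w t) S) has_real_derivative cumulant (w 0) (insert k S)) (at 0)"
proof -
  obtain j T where T: "S = insert j T" "j \<notin> T" using S(3) by (metis mk_disjoint_insert ex_in_conv)
  have fin: "finite T" "k \<notin> T" "j \<notin> insert k T" using S T by auto
  have "((\<lambda>t. (-1) ^ card T * walk_sum (w t) T j j) has_real_derivative
      (-1) ^ card T * - walk_sum (w 0) (insert k T) j j) (at 0)"
    by (intro DERIV_cmult has_derivative_walk_sum w fin)
  moreover have "insert k S = insert j (insert k T)" using T by auto
  ultimately show ?thesis using fin T by (simp add: cumulant_insert)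
qed

section \<open>Convolution of set functions\<close>

definition set_conv :: "('a set \<Rightarrow> real) \<Rightarrow> ('a set \<Rightarrow> real) \<Rightarrow> 'a set \<Rightarrow> real" where
  "set_conv F G S = (\<Sum>T\<in>Pow S. F T * G (S - T))"

definition delta_empty :: "'a set \<Rightarrow> real" where
  "delta_empty S = (if S = {} then 1 else 0)"

lemma set_conv_scaled_delta:
  assumes "finite S"
  shows "set_conv (\<lambda>T. c * delta_empty T) G S = c * G S"
proof -
  have "set_conv (\<lambda>T. c * delta_empty T) G S = (\<Sum>T\<in>Pow S. if T = {} then c * G S else 0)"
    unfolding set_conv_def delta_empty_def by (intro sum.cong) auto
  also have "\<dots> = c * G S" using assms by simp
  finally show ?thesis .
qed

lemma set_conv_zero_left: "set_conv (\<lambda>T. 0) G S = 0"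
  by (simp add: set_conv_def)

text \<open>
  Either \<open>k\<close> lies in the part that goes to \<open>F\<close> or in the one that goes to \<open>G\<close>: adjoining \<open>k\<close> is a
  derivation.
\<close>
lemma set_conv_insert:
  assumes "finite S" "k \<notin> S"
  shows "set_conv F G (insert k S)
    = set_conv (\<lambda>T. F (insert k T)) G S + set_conv F (\<lambda>T. G (insert k T)) S"
proof -
  have disj: "Pow S \<inter> insert k ` Pow S = {}" using assms by auto
  have inj: "inj_on (insert k) (Pow S)"
  proof (rule inj_onI)
    fix A B assume "A \<in> Pow S" "B \<in> Pow S" "insert k A = insert k B"
    then show "A = B" using assms(2) by (metis PowD insert_ident subsetD)
  qed
  have "set_conv F G (insert k S) = (\<Sum>T\<in>Pow S. F T * G (insert k S - T))
      + (\<Sum>T\<in>Pow S. F (insert k T) * G (insert k S - insert k T))"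
    unfolding set_conv_def Pow_insert using assms disj
    by (subst sum.union_disjoint) (simp_all add: sum.reindex[OF inj])
  also have "(\<Sum>T\<in>Pow S. F T * G (insert k S - T)) = set_conv F (\<lambda>T. G (insert k T)) S"
    unfolding set_conv_def
  proof (intro sum.cong refl)
    fix T assume "T \<in> Pow S"
    then have "insert k S - T = insert k (S - T)" using assms by auto
    then show "F T * G (insert k S - T) = F T * G (insert k (S - T))" by simp
  qed
  also have "(\<Sum>T\<in>Pow S. F (insert k T) * G (insert k S - insert k T))
      = set_conv (\<lambda>T. F (insert k T)) G S"
    unfolding set_conv_def
  proof (intro sum.cong refl)
    fix T assume "T \<in> Pow S"
    then have "insert k S - insert k T = S - T" using assms by auto
    then show "F (insert k T) * G (insert k S - insert k T) = F (insert k T) * G (S - T)" by simp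
  qed
  finally show ?thesis by simp
qed


text \<open>
  Both sides sum over the pairs of disjoint subsets. This is all of the commutativity and
  associativity of the convolution that the exponential needs.
\<close>
lemma set_conv_left_commute:
  assumes "finite S"
  shows "set_conv F (set_conv G H) S = set_conv G (set_conv F H) S"
proof -
  have *: "set_conv F (set_conv G H) S
      = (\<Sum>(T, U)\<in>(SIGMA T:Pow S. Pow (S - T)). F T * (G U * H (S - T - U)))" for F G :: "'a set \<Rightarrow> real"
    unfolding set_conv_def sum_distrib_left using assms by (subst sum.Sigma) auto
  show ?thesis unfolding *
    by (rule sum.reindex_bij_witness[of _ "\<lambda>(T, U). (U, T)" "\<lambda>(T, U). (U, T)"])
      (auto simp: Diff_eq Int_ac)
qed

lemma set_conv_add_left: "set_conv (\<lambda>T. F T + G T) H S = set_conv F H S + set_conv G H S"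
  by (simp add: set_conv_def algebra_simps sum.distrib)

lemma set_conv_add_right: "set_conv F (\<lambda>T. G T + H T) S = set_conv F G S + set_conv F H S"
  by (simp add: set_conv_def algebra_simps sum.distrib)

lemma set_conv_scale_right: "set_conv F (\<lambda>T. c * G T) S = c * set_conv F G S"
  by (simp add: set_conv_def sum_distrib_left mult.left_commute)

lemma set_conv_sum_right: "set_conv F (\<lambda>T. \<Sum>i\<in>I. G i T) S = (\<Sum>i\<in>I. set_conv F (G i) S)"
  by (simp add: set_conv_def sum_distrib_left) (rule sum.swap)

lemma set_conv_cong:
  assumes "\<And>T. T \<subseteq> S \<Longrightarrow> F T = F' T" "\<And>T. T \<subseteq> S \<Longrightarrow> G T = G' T"
  shows "set_conv F G S = set_conv F' G' S"
  unfolding set_conv_def using assms by (intro sum.cong) auto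

text \<open>
  The convolution of \<open>F\<close> with the exponential series of \<open>N\<close>, truncated at order \<open>n\<close>. If \<open>N\<close> vanishes
  at the empty set, the truncation changes nothing on sets with at most \<open>n\<close> elements.
\<close>
definition set_exp :: "nat \<Rightarrow> ('a set \<Rightarrow> real) \<Rightarrow> ('a set \<Rightarrow> real) \<Rightarrow> 'a set \<Rightarrow> real" where
  "set_exp n N F S = (\<Sum>j\<le>n. (set_conv N ^^ j) F S / fact j)"

lemma set_conv_power_eq_0:
  assumes "N {} = 0" "finite S" "card S < j"
  shows "(set_conv N ^^ j) F S = 0"
  using assms(2,3)
proof (induction j arbitrary: S)
  case (Suc j)
  have "N T * (set_conv N ^^ j) F (S - T) = 0" if "T \<subseteq> S" for T
  proof (cases "T = {}")
    case False
    then have "card (S - T) < card S" using that Suc.prems by (intro psubset_card_mono) auto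
    then show ?thesis using Suc by simp
  qed (use assms in simp)
  then show ?case
    unfolding funpow.simps o_apply set_conv_def[of N "(set_conv N ^^ j) F"]
    by (intro sum.neutral) blast
qed simp

text \<open>
  For a family \<open>F t\<close> of set functions, adjoining \<open>k\<close> to the argument and differentiating at \<open>t = 0\<close>
  are both derivations for the convolution, hence so is their difference \<open>H\<close>. The restriction to
  sets with fewer than \<open>n\<close> elements is due to the truncation of the exponential: adjoining \<open>k\<close> must
  not lead beyond \<open>n\<close> elements.
\<close>
definition defect :: "nat \<Rightarrow> 'a \<Rightarrow> (real \<Rightarrow> 'a set \<Rightarrow> real) \<Rightarrow> ('a set \<Rightarrow> real) \<Rightarrow> bool" where
  "defect n k F H \<longleftrightarrow> (\<forall>S. finite S \<longrightarrow> k \<notin> S \<longrightarrow> card S < n \<longrightarrow>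
     ((\<lambda>t. F t S) has_real_derivative F 0 (insert k S) - H S) (at 0))"

lemma defectD:
  "defect n k F H \<Longrightarrow> finite S \<Longrightarrow> k \<notin> S \<Longrightarrow> card S < n \<Longrightarrow>
   ((\<lambda>t. F t S) has_real_derivative F 0 (insert k S) - H S) (at 0)"
  by (simp add: defect_def)

lemma defect_cong:
  "defect n k F H \<Longrightarrow> (\<And>S. finite S \<Longrightarrow> k \<notin> S \<Longrightarrow> card S < n \<Longrightarrow> H S = K S) \<Longrightarrow> defect n k F K"
  by (simp add: defect_def)

lemma defect_delta_empty: "defect n k (\<lambda>t. delta_empty) (\<lambda>S. 0)"
  by (simp add: defect_def delta_empty_def)

lemma defect_set_conv:
  assumes F: "defect n k F H" and G: "defect n k G K"
  shows "defect n k (\<lambda>t. set_conv (F t) (G t)) (\<lambda>S. set_conv H (G 0) S + set_conv (F 0) K S)"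
  unfolding defect_def
proof (intro allI impI)
  fix S :: "'a set" assume S: "finite S" "k \<notin> S" and n: "card S < n"
  have sub: "finite T" "k \<notin> T" "card T < n" if "T \<subseteq> S" for T
    using that S n card_mono[OF S(1) that] finite_subset[OF that S(1)] by auto
  have "((\<lambda>t. set_conv (F t) (G t) S) has_real_derivative
     (\<Sum>T\<in>Pow S. F 0 T * (G 0 (insert k (S - T)) - K (S - T))
       + (F 0 (insert k T) - H T) * G 0 (S - T))) (at 0)"
    unfolding set_conv_def
    by (intro DERIV_sum DERIV_mult' defectD[OF F] defectD[OF G] sub) auto
  also have "(\<Sum>T\<in>Pow S. F 0 T * (G 0 (insert k (S - T)) - K (S - T))
       + (F 0 (insert k T) - H T) * G 0 (S - T))
     = set_conv (F 0) (G 0) (insert k S) - (set_conv H (G 0) S + set_conv (F 0) K S)"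
    unfolding set_conv_insert[OF S] unfolding set_conv_def
    by (simp add: sum.distrib sum_subtractf algebra_simps)
  finally show "((\<lambda>t. set_conv (F t) (G t) S) has_real_derivative
     set_conv (F 0) (G 0) (insert k S) - (set_conv H (G 0) S + set_conv (F 0) K S)) (at 0)" .
qed

lemma defect_sum:
  assumes "\<And>i. i \<in> I \<Longrightarrow> defect n k (F i) (H i)"
  shows "defect n k (\<lambda>t S. \<Sum>i\<in>I. F i t S) (\<lambda>S. \<Sum>i\<in>I. H i S)"
  using assms by (auto simp: defect_def sum_subtractf[symmetric] intro!: DERIV_sum)

lemma defect_divide:
  assumes "defect n k F H"
  shows "defect n k (\<lambda>t S. F t S / c) (\<lambda>S. H S / c)"
  using assms by (auto simp: defect_def diff_divide_distrib[symmetric] intro!: DERIV_cdivide)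

text \<open>
  The power rule. The hypothesis on \<open>F\<close> says that \<open>M\<close> is the logarithmic derivative of \<open>F\<close>.
\<close>
lemma defect_set_conv_power:
  assumes N: "defect n k N H" and F: "defect n k F (set_conv M (F 0))"
  shows "defect n k (\<lambda>t. (set_conv (N t) ^^ j) (F t))
    (\<lambda>S. j * set_conv H ((set_conv (N 0) ^^ (j - 1)) (F 0)) S
         + set_conv M ((set_conv (N 0) ^^ j) (F 0)) S)"
proof (induction j)
  case 0
  then show ?case using F by simp
next
  case (Suc j)
  have step: "j = 0 \<or> set_conv (N 0) (set_conv H ((set_conv (N 0) ^^ (j - Suc 0)) (F 0))) S
      = set_conv H ((set_conv (N 0) ^^ j) (F 0)) S" if "finite S" for S
    by (cases j) (simp_all add: set_conv_left_commute[OF that, of "N 0" H])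
  show ?case
    by (rule defect_cong, simp, rule defect_set_conv[OF N Suc])
      (simp add: set_conv_add_right set_conv_scale_right step
        set_conv_left_commute[of _ "N 0" M] algebra_simps)
qed

text \<open>
  For the derivation at hand, the logarithmic derivative of the exponential of \<open>N\<close> is \<open>H\<close>, the
  derivative of \<open>N\<close>, and logarithmic derivatives of factors add up.
\<close>
lemma defect_set_exp:
  assumes N: "defect n k N H" and F: "defect n k F (set_conv M (F 0))" and N0: "N 0 {} = 0"
  shows "defect n k (\<lambda>t. set_exp n (N t) (F t))
    (set_conv (\<lambda>T. H T + M T) (set_exp n (N 0) (F 0)))"
  unfolding set_exp_def
proof (rule defect_cong)
  let ?G = "\<lambda>j. (set_conv (N 0) ^^ j) (F 0)"
  show "defect n k (\<lambda>t S. \<Sum>j\<le>n. (set_conv (N t) ^^ j) (F t) S / fact j)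
    (\<lambda>S. \<Sum>j\<le>n. (j * set_conv H (?G (j - 1)) S + set_conv M (?G j) S) / fact j)"
    by (intro defect_sum defect_divide defect_set_conv_power N F)
  fix S :: "'a set" assume S: "finite S" "k \<notin> S" "card S < n"
  have right: "set_conv K (\<lambda>S. \<Sum>j\<in>J. ?G j S / fact j) S = (\<Sum>j\<in>J. set_conv K (?G j) S / fact j)"
    for K and J :: "nat set"
    using set_conv_scale_right[of K "1 / fact j" "?G j" S for j]
    by (simp add: set_conv_sum_right)
  have "(\<Sum>j\<le>n. j * set_conv H (?G (j - 1)) S / fact j) = (\<Sum>j<n. set_conv H (?G j) S / fact j)"
  proof -
    obtain n' where n': "n = Suc n'" using S(3) by (cases n) auto
    have "(\<Sum>j\<le>n. j * set_conv H (?G (j - 1)) S / fact j)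
        = (\<Sum>j\<le>n'. Suc j * set_conv H (?G j) S / fact (Suc j))"
      unfolding n' by (subst sum.atMost_Suc_shift) simp
    also have "\<dots> = (\<Sum>j\<le>n'. set_conv H (?G j) S / fact j)"
      by (intro sum.cong refl) (simp add: divide_simps del: of_nat_Suc)
    finally show ?thesis by (simp add: n' lessThan_Suc_atMost)
  qed
  also have "\<dots> = set_conv H (\<lambda>S. \<Sum>j<n. ?G j S / fact j) S" by (simp add: right)
  also have "\<dots> = set_conv H (\<lambda>S. \<Sum>j\<le>n. ?G j S / fact j) S"
  proof (intro set_conv_cong refl)
    fix T assume "T \<subseteq> S"
    then have "finite T" "card T < n"
      using S card_mono[of S T] finite_subset[of T S] by auto
    \<comment> \<open>The last term of the truncated series has no counterpart in its derivative.\<close>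
    then have "?G n T = 0" using N0 by (rule_tac set_conv_power_eq_0)
    then show "(\<Sum>j<n. ?G j T / fact j) = (\<Sum>j\<le>n. ?G j T / fact j)"
      by (simp add: lessThan_Suc_atMost[symmetric])
  qed
  finally show "(\<Sum>j\<le>n. (j * set_conv H (?G (j - 1)) S + set_conv M (?G j) S) / fact j)
      = set_conv (\<lambda>T. H T + M T) (\<lambda>S. \<Sum>j\<le>n. ?G j S / fact j) S"
    by (simp add: add_divide_distrib sum.distrib set_conv_add_left right)
qed

definition sized_cumulant :: "('a \<Rightarrow> 'a \<Rightarrow> real) \<Rightarrow> nat \<Rightarrow> 'a set \<Rightarrow> real" where
  "sized_cumulant w l T = (if card T = l then cumulant w T else 0)"

text \<open>
  The convolution product of the exponentials of \<open>sized_cumulant w l\<close> over the block sizes \<open>l\<close> in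
  \<open>ls\<close>. With all block sizes up to \<open>n\<close>, this is the exponential of the cumulants on sets with at most
  \<open>n\<close> elements: the sum, over the set partitions of the argument, of the products of the cumulants of
  the blocks.
\<close>
definition moment :: "nat \<Rightarrow> ('a \<Rightarrow> 'a \<Rightarrow> real) \<Rightarrow> nat list \<Rightarrow> 'a set \<Rightarrow> real" where
  "moment n w ls = foldr (\<lambda>l. set_exp n (sized_cumulant w l)) ls delta_empty"

lemma moment_Nil [simp]: "moment n w [] = delta_empty"
  and moment_Cons [simp]: "moment n w (l # ls) = set_exp n (sized_cumulant w l) (moment n w ls)"
  by (simp_all add: moment_def)

context
  fixes w :: "real \<Rightarrow> 'a \<Rightarrow> 'a \<Rightarrow> real" and k :: 'a
  assumes w: "\<And>u v. ((\<lambda>t. w t u v) has_real_derivative - w 0 u k * w 0 k v) (at 0)"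
begin

text \<open>
  Adjoining \<open>k\<close> contributes on the sets \<open>T\<close> with \<open>l - 1\<close> elements, differentiating on those with \<open>l\<close>
  elements, both times the cumulant of \<open>insert k T\<close>. So the difference does not vanish for a single
  \<open>l\<close>, but it telescopes when summed over \<open>l\<close>.
\<close>
definition cumulant_defect :: "nat \<Rightarrow> 'a set \<Rightarrow> real" where
  "cumulant_defect l T = sized_cumulant (w 0) l (insert k T)
     - (if T \<noteq> {} \<and> card T = l then cumulant (w 0) (insert k T) else 0)"

lemma defect_sized_cumulant:
  "defect n k (\<lambda>t. sized_cumulant (w t) l) (cumulant_defect l)"
  unfolding defect_def
proof (intro allI impI)
  fix S :: "'a set" assume "finite S" "k \<notin> S" "card S < n"
  then have "((\<lambda>t. cumulant (w t) S) has_real_derivative cumulant (w 0) (insert k S)) (at 0)"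
    if "S \<noteq> {}" using has_derivative_cumulant[where w = w and k = k, OF w] that by blast
  then show "((\<lambda>t. sized_cumulant (w t) l S) has_real_derivative
      sized_cumulant (w 0) l (insert k S) - cumulant_defect l S) (at 0)"
    by (cases "S = {}") (auto simp: sized_cumulant_def cumulant_defect_def cumulant_def cong: if_cong)
qed

lemma defect_moment:
  "0 \<notin> set ls \<Longrightarrow> defect n k (\<lambda>t. moment n (w t) ls)
    (set_conv (\<lambda>T. \<Sum>l\<leftarrow>ls. cumulant_defect l T) (moment n (w 0) ls))"
proof (induction ls)
  case Nil
  then show ?case by (simp add: defect_delta_empty set_conv_zero_left)
next
  case (Cons l ls)
  then show ?case
    using defect_set_exp[OF defect_sized_cumulant[of n l] Cons.IH]
    by (simp add: sized_cumulant_def)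
qed

text \<open>
  On nonempty sets with fewer than \<open>n\<close> elements the sum over the block sizes telescopes to 0. At
  the empty set only the cumulant \<open>w 0 k k\<close> of \<open>{k}\<close> is left. So the defect of the moments is
  multiplication with this number.
\<close>
lemma has_derivative_moment:
  assumes S: "finite S" "k \<notin> S" "card S < n"
  shows "((\<lambda>t. moment n (w t) [1..<Suc n] S) has_real_derivative
    moment n (w 0) [1..<Suc n] (insert k S) - w 0 k k * moment n (w 0) [1..<Suc n] S) (at 0)"
proof -
  let ?M = "\<lambda>T. \<Sum>l\<leftarrow>[1..<Suc n]. cumulant_defect l T"
  have M: "?M T = w 0 k k * delta_empty T" if "T \<subseteq> S" for T
  proof -
    have T: "finite T" "k \<notin> T" "card T < n"
      using S that card_mono[of S T] finite_subset[of T S] by auto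
    have "?M T = (\<Sum>l=1..<Suc n. if l = Suc (card T) then cumulant (w 0) (insert k T) else 0)
       - (\<Sum>l=1..<Suc n. if l = card T then (if T = {} then 0 else cumulant (w 0) (insert k T)) else 0)"
      unfolding sum_list_distinct_conv_sum_set[OF distinct_upt] set_upt sum_subtractf[symmetric]
      using T by (intro sum.cong) (auto simp: cumulant_defect_def sized_cumulant_def)
    also have "\<dots> = w 0 k k * delta_empty T"
      using T by (auto simp: delta_empty_def card_gt_0_iff Suc_le_eq simp del: sum.op_ivl_Suc)
    finally show ?thesis .
  qed
  have "set_conv ?M (moment n (w 0) [1..<Suc n]) S
      = set_conv (\<lambda>T. w 0 k k * delta_empty T) (moment n (w 0) [1..<Suc n]) S"
    by (intro set_conv_cong refl M)
  then show ?thesis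
    using defectD[OF defect_moment S, of "[1..<Suc n]"] set_conv_scaled_delta[OF S(1)] by simp
qed

end

section \<open>Expansion over cycle types\<close>

text \<open>
  An arrangement of \<open>S\<close> is the choice of the set of its first \<open>l\<close> elements together with an
  arrangement of this set and one of its complement. So convolutions are sums over arrangements that
  are cut into blocks.
\<close>
lemma sum_permutations_of_set_split:
  assumes "finite S"
  shows "(\<Sum>xs\<in>permutations_of_set S. f (take l xs) * g (drop l xs) :: real)
    = (\<Sum>T | T \<subseteq> S \<and> card T = min l (card S).
         (\<Sum>ys\<in>permutations_of_set T. f ys) * (\<Sum>zs\<in>permutations_of_set (S - T). g zs))"
proof -
  let ?Z = "{T. T \<subseteq> S \<and> card T = min l (card S)}"
  let ?P = "\<lambda>T. permutations_of_set T \<times> permutations_of_set (S - T)"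
  have "finite ?Z" using assms by (auto intro: finite_subset[of _ "Pow S"])
  then have "(\<Sum>T\<in>?Z. (\<Sum>ys\<in>permutations_of_set T. f ys) * (\<Sum>zs\<in>permutations_of_set (S - T). g zs))
      = (\<Sum>(T, ys, zs)\<in>Sigma ?Z ?P. f ys * g zs)"
    unfolding sum_product sum.cartesian_product by (subst sum.Sigma) auto
  also have "\<dots> = (\<Sum>xs\<in>permutations_of_set S. f (take l xs) * g (drop l xs))"
  proof (rule sum.reindex_bij_witness[of _ "\<lambda>xs. (set (take l xs), take l xs, drop l xs)"
        "\<lambda>(T, ys, zs). ys @ zs"])
    fix x assume "x \<in> Sigma ?Z ?P"
    then obtain T ys zs where x: "x = (T, ys, zs)" "T \<subseteq> S" "card T = min l (card S)"
      "ys \<in> permutations_of_set T" "zs \<in> permutations_of_set (S - T)" by blast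
    have yz: "set ys = T" "distinct ys" "set zs = S - T" "distinct zs"
      using x permutations_of_setD by blast+
    have len: "length ys = min l (card S)"
      using x by (simp add: length_finite_permutations_of_set)
    have "length zs = card S - min l (card S)"
      using x(2-5) assms finite_subset[OF x(2)]
      by (simp add: length_finite_permutations_of_set card_Diff_subset)
    with len have "take l (ys @ zs) = ys \<and> drop l (ys @ zs) = zs"
      by (cases "l \<le> card S") simp_all
    then show "(set (take l (case x of (T, ys, zs) \<Rightarrow> ys @ zs)), take l (case x of (T, ys, zs) \<Rightarrow> ys @ zs),
        drop l (case x of (T, ys, zs) \<Rightarrow> ys @ zs)) = x"
      and "f (take l (case x of (T, ys, zs) \<Rightarrow> ys @ zs)) * g (drop l (case x of (T, ys, zs) \<Rightarrow> ys @ zs))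
        = (case x of (T, ys, zs) \<Rightarrow> f ys * g zs)"
      using x yz by auto
    show "(case x of (T, ys, zs) \<Rightarrow> ys @ zs) \<in> permutations_of_set S"
      using x yz by (auto intro!: permutations_of_setI)
  next
    fix xs assume xs: "xs \<in> permutations_of_set S"
    have d: "set xs = S" "distinct xs" "length xs = card S"
      using permutations_of_setD[OF xs] length_finite_permutations_of_set[OF xs] by auto
    have "set (take l xs) \<inter> set (drop l xs) = {}" "set (take l xs) \<union> set (drop l xs) = S"
      using d by (simp_all add: set_take_disj_set_drop_if_distinct flip: set_append)
    then have "set (drop l xs) = S - set (take l xs)" by blast
    moreover have "card (set (take l xs)) = min l (card S)"
      using d by (simp add: distinct_card min.commute)
    ultimately show "(set (take l xs), take l xs, drop l xs) \<in> Sigma ?Z ?P"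
      using d set_take_subset[of l xs] by (auto intro!: permutations_of_setI)
  qed auto
  finally show ?thesis by simp
qed

text \<open>
  Cuts \<open>xs\<close> into consecutive blocks with the lengths in \<open>bl\<close> and multiplies the weights of the
  closed walks through the blocks.
\<close>
primrec block_walks :: "('a \<Rightarrow> 'a \<Rightarrow> real) \<Rightarrow> nat list \<Rightarrow> 'a list \<Rightarrow> real" where
  "block_walks w [] xs = 1"
| "block_walks w (l # bl) xs = closed_walk w (take l xs) * block_walks w bl (drop l xs)"

definition block_conv :: "('a \<Rightarrow> 'a \<Rightarrow> real) \<Rightarrow> nat list \<Rightarrow> 'a set \<Rightarrow> real" where
  "block_conv w bl = foldr (\<lambda>l. set_conv (sized_cumulant w l)) bl delta_empty"

lemma block_conv_Nil [simp]: "block_conv w [] = delta_empty"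
  and block_conv_Cons [simp]:
    "block_conv w (l # bl) = set_conv (sized_cumulant w l) (block_conv w bl)"
  by (simp_all add: block_conv_def)

lemma block_conv_replicate:
  "block_conv w (replicate j l @ bl) = (set_conv (sized_cumulant w l) ^^ j) (block_conv w bl)"
  by (induction j) simp_all

lemma block_conv_sized:
  assumes "finite S"
  shows "block_conv w (l # bl) S
    = (\<Sum>T | T \<subseteq> S \<and> card T = l. cumulant w T * block_conv w bl (S - T))"
  unfolding block_conv_Cons set_conv_def sized_cumulant_def using assms
  by (intro sum.mono_neutral_cong_right) auto

lemma block_conv_eq_0:
  "finite S \<Longrightarrow> card S \<noteq> sum_list bl \<Longrightarrow> block_conv w bl S = 0"
proof (induction bl arbitrary: S)
  case (Cons l bl)
  have "block_conv w bl (S - T) = 0" if "T \<subseteq> S" "card T = l" for T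
  proof (rule Cons.IH)
    have "card S = card T + card (S - T)"
      using that Cons.prems card_mono[of S T] by (simp add: card_Diff_subset finite_subset)
    then show "card (S - T) \<noteq> sum_list bl" using Cons.prems that by auto
  qed (use Cons.prems in auto)
  then show ?case unfolding block_conv_sized[OF Cons.prems(1)] by (intro sum.neutral) auto
qed (auto simp: delta_empty_def)

lemma block_conv_eq_sum_walks:
  "finite S \<Longrightarrow> card S = sum_list bl \<Longrightarrow> block_conv w bl S
    = (\<Prod>l\<leftarrow>bl. (-1) ^ (l - 1) / real l) * (\<Sum>xs\<in>permutations_of_set S. block_walks w bl xs)"
proof (induction bl arbitrary: S)
  case (Cons l bl)
  let ?c = "(-1) ^ (l - 1) / real l" and ?d = "\<Prod>l\<leftarrow>bl. (-1) ^ (l - 1) / real l"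
  have l: "min l (card S) = l" using Cons.prems by simp
  have IH: "block_conv w bl (S - T) = ?d * (\<Sum>xs\<in>permutations_of_set (S - T). block_walks w bl xs)"
    if "T \<subseteq> S" "card T = l" for T
    using that Cons.prems by (intro Cons.IH) (simp_all add: card_Diff_subset finite_subset)
  have "block_conv w (l # bl) S = (\<Sum>T | T \<subseteq> S \<and> card T = l. ?c * ?d *
      (cycle_sum w T * (\<Sum>xs\<in>permutations_of_set (S - T). block_walks w bl xs)))"
    unfolding block_conv_sized[OF Cons.prems(1)]
    by (intro sum.cong) (auto simp: IH cumulant_def)
  also have "\<dots> = ?c * ?d * (\<Sum>xs\<in>permutations_of_set S. block_walks w (l # bl) xs)"
    unfolding sum_distrib_left[symmetric] block_walks.simps
      sum_permutations_of_set_split[OF Cons.prems(1)] l cycle_sum_def by simp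
  finally show ?case by simp
qed (simp add: delta_empty_def)

text \<open>
  The block lengths of type \<open>m\<close> in the order in which the Kronecker product in \<open>Xi_mat\<close> takes its
  factors.
\<close>
definition blocks :: "(nat \<Rightarrow> nat) \<Rightarrow> nat list \<Rightarrow> nat list" where
  "blocks m ls = concat (map (\<lambda>l. replicate (m l) l) ls)"

lemma blocks_Nil [simp]: "blocks m [] = []"
  and blocks_Cons [simp]: "blocks m (l # ls) = replicate (m l) l @ blocks m ls"
  by (simp_all add: blocks_def)

lemma blocks_fun_upd: "l \<notin> set ls \<Longrightarrow> blocks (m(l := j)) ls = blocks m ls"
  unfolding blocks_def by (intro arg_cong[where f = concat] map_cong) auto

lemma sum_list_blocks: "sum_list (blocks m ls) = (\<Sum>l\<leftarrow>ls. l * m l)"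
  by (induction ls) (simp_all add: sum_list_replicate)

lemma prod_list_blocks: "(\<Prod>l\<leftarrow>blocks m ls. f l :: real) = (\<Prod>l\<leftarrow>ls. f l ^ m l)"
  by (induction ls) (simp_all add: prod_list_replicate)

lemma set_conv_power_sum:
  "(set_conv N ^^ j) (\<lambda>S. \<Sum>i\<in>I. c i * F i S) = (\<lambda>S. \<Sum>i\<in>I. c i * (set_conv N ^^ j) (F i) S)"
proof (induction j)
  case (Suc j)
  show ?case
    by (rule ext) (simp add: Suc.IH set_conv_sum_right set_conv_scale_right)
qed simp

lemma sum_PiE_insert:
  assumes "x \<notin> A"
  shows "(\<Sum>m\<in>PiE (insert x A) (\<lambda>_. B). f m :: real) = (\<Sum>y\<in>B. \<Sum>m\<in>PiE A (\<lambda>_. B). f (m(x := y)))"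
proof -
  have "(\<Sum>m\<in>PiE (insert x A) (\<lambda>_. B). f m) = (\<Sum>(y, m)\<in>B \<times> PiE A (\<lambda>_. B). f (m(x := y)))"
    unfolding PiE_insert_eq using assms
    by (subst sum.reindex[OF inj_combinator]) (auto intro!: sum.cong)
  then show ?thesis by (simp add: sum.cartesian_product)
qed

text \<open>
  Multiplying out the exponential series: the tuple \<open>m\<close> selects the term of order \<open>m l\<close> from the
  series for block size \<open>l\<close>.
\<close>
lemma moment_expand:
  "distinct ls \<Longrightarrow> moment n w ls
    = (\<lambda>S. \<Sum>m\<in>PiE (set ls) (\<lambda>_. {..n}). (1 / (\<Prod>l\<in>set ls. fact (m l))) * block_conv w (blocks m ls) S)"
proof (induction ls)
  case Nil
  then show ?case by simp
next
  case (Cons l ls)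
  let ?M = "PiE (set ls) (\<lambda>_. {..n})"
  have l: "l \<notin> set ls" and IH: "moment n w ls = (\<lambda>S. \<Sum>m\<in>?M.
      (1 / (\<Prod>l\<in>set ls. fact (m l))) * block_conv w (blocks m ls) S)"
    using Cons by auto
  show ?case
  proof
    fix S
    have "moment n w (l # ls) S = (\<Sum>j\<le>n. \<Sum>m\<in>?M. (1 / (fact j * (\<Prod>l\<in>set ls. fact (m l))))
        * block_conv w (replicate j l @ blocks m ls) S)"
      unfolding moment_Cons set_exp_def IH set_conv_power_sum block_conv_replicate
      by (intro sum.cong refl) (simp add: sum_divide_distrib mult.commute)
    also have "\<dots> = (\<Sum>j\<le>n. \<Sum>m\<in>?M. (1 / (\<Prod>i\<in>set (l # ls). fact ((m(l := j)) i)))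
        * block_conv w (blocks (m(l := j)) (l # ls)) S)"
    proof (intro sum.cong refl)
      fix j m
      have "(\<Prod>i\<in>set ls. fact ((m(l := j)) i)) = (\<Prod>i\<in>set ls. fact (m i) :: real)"
        using l by (intro prod.cong) auto
      then show "(1 / (fact j * (\<Prod>l\<in>set ls. fact (m l)))) * block_conv w (replicate j l @ blocks m ls) S
        = (1 / (\<Prod>i\<in>set (l # ls). fact ((m(l := j)) i))) * block_conv w (blocks (m(l := j)) (l # ls)) S"
        using l by (simp add: blocks_fun_upd del: fun_upd_apply) simp
    qed
    also have "\<dots> = (\<Sum>m\<in>PiE (set (l # ls)) (\<lambda>_. {..n}).
        (1 / (\<Prod>l\<in>set (l # ls). fact (m l))) * block_conv w (blocks m (l # ls)) S)"
      unfolding list.set sum_PiE_insert[OF l] ..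
    finally show "moment n w (l # ls) S = (\<Sum>m\<in>PiE (set (l # ls)) (\<lambda>_. {..n}).
        (1 / (\<Prod>l\<in>set (l # ls). fact (m l))) * block_conv w (blocks m (l # ls)) S)" .
  qed
qed

lemma sum_list_upt_Suc: "(\<Sum>l\<leftarrow>[1..<Suc r]. f l :: nat) = (\<Sum>l=1..r. f l)"
  unfolding sum_list_distinct_conv_sum_set[OF distinct_upt] set_upt atLeastLessThanSuc_atLeastAtMost ..

lemma weight_tuples_le:
  assumes "m \<in> weight_tuples r" "l \<in> {1..r}"
  shows "m l \<le> r"
proof -
  have "m l \<le> l * m l" using assms by simp
  also have "\<dots> \<le> (\<Sum>l=1..r. l * m l)" by (rule member_le_sum) (use assms in auto)
  finally show ?thesis using assms by (simp add: weight_tuples_def)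
qed

text \<open>
  The blocks of a term must exhaust \<open>S\<close>, so only the tuples of weight \<open>card S\<close> contribute.
\<close>
theorem moment_eq_sum_weight_tuples:
  assumes S: "finite S" "card S = r"
  shows "moment r w [1..<Suc r] S = (\<Sum>m\<in>weight_tuples r.
    (-1) ^ (r - (\<Sum>l=1..r. m l)) / (\<Prod>l=1..r. fact (m l) * real l ^ m l)
    * (\<Sum>xs\<in>permutations_of_set S. block_walks w (blocks m [1..<Suc r]) xs))"
proof -
  let ?ls = "[1..<Suc r]"
  have set: "set ?ls = {1..r}" by auto
  have "moment r w ?ls S = (\<Sum>m\<in>PiE {1..r} (\<lambda>_. {..r}).
      (1 / (\<Prod>l=1..r. fact (m l))) * block_conv w (blocks m ?ls) S)"
    unfolding moment_expand[OF distinct_upt] set ..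
  also have "\<dots> = (\<Sum>m\<in>weight_tuples r. (1 / (\<Prod>l=1..r. fact (m l))) * block_conv w (blocks m ?ls) S)"
  proof (rule sum.mono_neutral_right)
    show "weight_tuples r \<subseteq> PiE {1..r} (\<lambda>_. {..r})"
    proof
      fix m assume "m \<in> weight_tuples r"
      then show "m \<in> PiE {1..r} (\<lambda>_. {..r})"
        using weight_tuples_le[of m r] by (auto simp: weight_tuples_def PiE_iff)
    qed
    show "\<forall>m\<in>PiE {1..r} (\<lambda>_. {..r}) - weight_tuples r.
        (1 / (\<Prod>l=1..r. fact (m l))) * block_conv w (blocks m ?ls) S = 0"
    proof
      fix m assume m: "m \<in> PiE {1..r} (\<lambda>_. {..r}) - weight_tuples r"
      then have "card S \<noteq> sum_list (blocks m ?ls)"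
        unfolding sum_list_blocks sum_list_upt_Suc S by (auto simp: weight_tuples_def PiE_iff)
      then show "(1 / (\<Prod>l=1..r. fact (m l))) * block_conv w (blocks m ?ls) S = 0"
        using block_conv_eq_0[OF S(1)] by simp
    qed
  qed (auto intro: finite_PiE)
  also have "\<dots> = (\<Sum>m\<in>weight_tuples r.
    (-1) ^ (r - (\<Sum>l=1..r. m l)) / (\<Prod>l=1..r. fact (m l) * real l ^ m l)
    * (\<Sum>xs\<in>permutations_of_set S. block_walks w (blocks m ?ls) xs))"
  proof (intro sum.cong refl)
    fix m assume m: "m \<in> weight_tuples r"
    then have w: "(\<Sum>l=1..r. l * m l) = r" by (simp add: weight_tuples_def)
    have "(\<Sum>l=1..r. (l - 1) * m l) + (\<Sum>l=1..r. m l) = (\<Sum>l=1..r. l * m l)"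
      unfolding sum.distrib[symmetric] by (intro sum.cong refl) (auto simp: diff_mult_distrib)
    then have e: "(\<Sum>l=1..r. (l - 1) * m l) = r - (\<Sum>l=1..r. m l)" using w by simp
    have "(\<Prod>l\<leftarrow>blocks m ?ls. (-1) ^ (l - 1) / real l) = (\<Prod>l=1..r. ((-1) ^ (l - 1) / real l) ^ m l)"
      unfolding prod_list_blocks prod.distinct_set_conv_list[OF distinct_upt, symmetric] set ..
    also have "\<dots> = (-1) ^ (r - (\<Sum>l=1..r. m l)) / (\<Prod>l=1..r. real l ^ m l)"
      using e by (simp add: power_divide prod_dividef power_mult[symmetric] power_sum[symmetric])
    finally have c: "(\<Prod>l\<leftarrow>blocks m ?ls. (-1) ^ (l - 1) / real l)
        = (-1) ^ (r - (\<Sum>l=1..r. m l)) / (\<Prod>l=1..r. real l ^ m l)" .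
    have "card S = sum_list (blocks m ?ls)"
      unfolding sum_list_blocks sum_list_upt_Suc using w S by simp
    from block_conv_eq_sum_walks[OF S(1) this]
    show "(1 / (\<Prod>l=1..r. fact (m l))) * block_conv w (blocks m ?ls) S
      = (-1) ^ (r - (\<Sum>l=1..r. m l)) / (\<Prod>l=1..r. fact (m l) * real l ^ m l)
        * (\<Sum>xs\<in>permutations_of_set S. block_walks w (blocks m ?ls) xs)"
      unfolding c prod.distrib by simp
  qed
  finally show ?thesis .
qed

section \<open>Partial derivatives of the determinant and of its logarithm\<close>

lemma mat_inverse_nonsingular:
  fixes X :: "real mat"
  assumes "X \<in> carrier_mat n n" "det X \<noteq> 0"
  shows "the (mat_inverse X) \<in> carrier_mat n n"
    "X * the (mat_inverse X) = 1\<^sub>m n" "the (mat_inverse X) * X = 1\<^sub>m n"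
proof -
  have "mat_inverse X \<noteq> None"
    using mat_inverse(1)[OF assms(1), where b = "()"] det_non_zero_imp_unit[OF assms, where b = "()"]
    by blast
  then show "the (mat_inverse X) \<in> carrier_mat n n"
    "X * the (mat_inverse X) = 1\<^sub>m n" "the (mat_inverse X) * X = 1\<^sub>m n"
    using mat_inverse(2)[OF assms(1)] by auto
qed

lemma mat_inverse_eqI:
  fixes X :: "real mat"
  assumes X: "X \<in> carrier_mat n n" "det X \<noteq> 0" and Z: "Z \<in> carrier_mat n n" "X * Z = 1\<^sub>m n"
  shows "the (mat_inverse X) = Z"
proof -
  let ?Y = "the (mat_inverse X)"
  note Y = mat_inverse_nonsingular[OF X]
  have "?Y = ?Y * (X * Z)" using Y(1) Z by simp
  also have "\<dots> = ?Y * X * Z" using Y(1) X Z by (simp add: assoc_mult_mat)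
  also have "\<dots> = Z" using Y Z by simp
  finally show ?thesis .
qed

definition add_entry :: "real mat \<Rightarrow> nat \<Rightarrow> nat \<Rightarrow> real \<Rightarrow> real mat" where
  "add_entry X a b t = mat (dim_row X) (dim_col X)
     (\<lambda>(i, j). X $$ (i, j) + (if i = a \<and> j = b then t else 0))"

lemma add_entry_carrier [simp]: "X \<in> carrier_mat m n \<Longrightarrow> add_entry X a b t \<in> carrier_mat m n"
  by (auto simp: add_entry_def)

text \<open>
  Expand along column \<open>b\<close>: its cofactors do not see the changed entry, and the cofactor of this
  entry is an entry of the adjugate, hence \<open>det X\<close> times an entry of the inverse.
\<close>
lemma det_add_entry:
  assumes X: "X \<in> carrier_mat n n" "det X \<noteq> 0" and ab: "a < n" "b < n"
  shows "det (add_entry X a b t) = det X * (1 + t * the (mat_inverse X) $$ (b, a))"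
proof -
  let ?Y = "the (mat_inverse X)"
  note Y = mat_inverse_nonsingular[OF X] and adj = adj_mat[OF X(1)]
  have "adj_mat X = adj_mat X * (X * ?Y)" using Y adj by simp
  also have "\<dots> = (det X \<cdot>\<^sub>m 1\<^sub>m n) * ?Y"
    using assoc_mult_mat[OF adj(1) X(1) Y(1)] adj(3) by simp
  also have "\<dots> = det X \<cdot>\<^sub>m ?Y" using Y by (simp add: mult_smult_assoc_mat[of _ n n])
  finally have "adj_mat X $$ (b, a) = det X * ?Y $$ (b, a)" using Y ab by simp
  then have cof: "cofactor X a b = det X * ?Y $$ (b, a)"
    using X ab by (simp add: adj_mat_def)
  have delete: "cofactor (add_entry X a b t) i b = cofactor X i b" if "i < n" for i
  proof -
    have "mat_delete (add_entry X a b t) i b = mat_delete X i b"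
      using X that ab by (intro eq_matI) (auto simp: mat_delete_def add_entry_def)
    then show ?thesis by (simp add: cofactor_def)
  qed
  have "det (add_entry X a b t)
      = (\<Sum>i<n. (X $$ (i, b) + (if i = a then t else 0)) * cofactor X i b)"
    unfolding laplace_expansion_column[OF add_entry_carrier[OF X(1)] ab(2)]
    using X ab by (intro sum.cong refl) (simp add: delete, simp add: add_entry_def)
  also have "\<dots> = (\<Sum>i<n. X $$ (i, b) * cofactor X i b) + (\<Sum>i<n. if i = a then t * cofactor X i b else 0)"
    unfolding sum.distrib[symmetric] by (intro sum.cong) (auto simp: algebra_simps)
  also have "\<dots> = det X + t * cofactor X a b"
    using ab by (simp add: laplace_expansion_column[OF X(1) ab(2)])
  finally show ?thesis by (simp add: cof algebra_simps)
qed

text \<open>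
  The Sherman-Morrison formula for a perturbation of rank one that is supported on a single entry.
\<close>
lemma mat_inverse_add_entry:
  assumes X: "X \<in> carrier_mat n n" "det X \<noteq> 0" and ab: "a < n" "b < n"
    and t: "1 + t * the (mat_inverse X) $$ (b, a) \<noteq> 0" and ij: "i < n" "j < n"
  shows "the (mat_inverse (add_entry X a b t)) $$ (i, j) = the (mat_inverse X) $$ (i, j)
    - t * the (mat_inverse X) $$ (i, a) * the (mat_inverse X) $$ (b, j)
      / (1 + t * the (mat_inverse X) $$ (b, a))"
proof -
  define Y where "Y = the (mat_inverse X)"
  define q where "q = 1 + t * Y $$ (b, a)"
  let ?X' = "add_entry X a b t"
  let ?Z = "mat n n (\<lambda>(i, j). Y $$ (i, j) - t * Y $$ (i, a) * Y $$ (b, j) / q)"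
  have Y: "Y \<in> carrier_mat n n" "X * Y = 1\<^sub>m n"
    using mat_inverse_nonsingular[OF X] by (simp_all add: Y_def)
  have q: "q \<noteq> 0" using t by (simp add: q_def Y_def)
  have XY: "(\<Sum>k<n. X $$ (i, k) * Y $$ (k, j)) = (if i = j then 1 else 0)" if "i < n" "j < n" for i j
  proof -
    have "(X * Y) $$ (i, j) = (\<Sum>k<n. X $$ (i, k) * Y $$ (k, j))"
      using X Y(1) that by (simp add: scalar_prod_def atLeast0LessThan)
    moreover have "(X * Y) $$ (i, j) = 1\<^sub>m n $$ (i, j)" by (simp only: Y(2))
    ultimately have "(\<Sum>k<n. X $$ (i, k) * Y $$ (k, j)) = 1\<^sub>m n $$ (i, j)" by (rule trans[OF sym])
    then show ?thesis using that by simp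
  qed
  have "?X' * ?Z = 1\<^sub>m n"
  proof (rule eq_matI)
    fix i j assume "i < dim_row (1\<^sub>m n :: real mat)" "j < dim_col (1\<^sub>m n :: real mat)"
    then have ij: "i < n" "j < n" by auto
    have "(?X' * ?Z) $$ (i, j) = (\<Sum>k<n. (X $$ (i, k) + (if i = a \<and> k = b then t else 0))
        * (Y $$ (k, j) - t * Y $$ (k, a) * Y $$ (b, j) / q))"
      using X ij by (simp add: scalar_prod_def atLeast0LessThan add_entry_def)
    also have "\<dots> = (\<Sum>k<n. X $$ (i, k) * Y $$ (k, j)
        - t * Y $$ (b, j) / q * (X $$ (i, k) * Y $$ (k, a))
        + (if k = b then (if i = a then t * (Y $$ (k, j) - t * Y $$ (k, a) * Y $$ (b, j) / q) else 0) else 0))"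
      by (intro sum.cong refl) (simp add: algebra_simps)
    also have "\<dots> = (if i = j then 1 else 0) - t * Y $$ (b, j) / q * (if i = a then 1 else 0)
        + (if i = a then t * (Y $$ (b, j) - t * Y $$ (b, a) * Y $$ (b, j) / q) else 0)"
      using XY[OF ij] XY[OF ij(1) ab(1)] ab
      by (simp only: sum.distrib sum_subtractf sum_distrib_left[symmetric]) simp
    also have "\<dots> = (if i = j then 1 else 0)"
    proof -
      have "Y $$ (b, j) - t * Y $$ (b, a) * Y $$ (b, j) / q = Y $$ (b, j) * (q - t * Y $$ (b, a)) / q"
        using q by (simp add: field_simps)
      also have "q - t * Y $$ (b, a) = 1" by (simp add: q_def)
      finally show ?thesis by simp
    qed
    finally show "(?X' * ?Z) $$ (i, j) = 1\<^sub>m n $$ (i, j)" using ij by simp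
  qed (use add_entry_carrier[OF X(1), of a b t] in auto)
  moreover have "det ?X' \<noteq> 0" using X t by (simp add: det_add_entry[OF X ab])
  ultimately have "the (mat_inverse ?X') = ?Z"
    using X(1) by (intro mat_inverse_eqI[of _ n]) auto
  then show ?thesis using ij by (simp add: Y_def q_def)
qed

lemma mat_of_vec_add_unit:
  assumes "x \<in> carrier_vec (m * n)" "k < m * n"
  shows "mat_of_vec m n (x + t \<cdot>\<^sub>v unit_vec (dim_vec x) k)
    = add_entry (mat_of_vec m n x) (k mod m) (k div m) t"
proof (rule eq_matI)
  fix i j assume "i < dim_row (add_entry (mat_of_vec m n x) (k mod m) (k div m) t)"
    "j < dim_col (add_entry (mat_of_vec m n x) (k mod m) (k div m) t)"
  then have ij: "i < m" "j < n" by (auto simp: add_entry_def mat_of_vec_def)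
  have "j * m + i = k \<longleftrightarrow> i = k mod m \<and> j = k div m" using ij by auto
  then show "mat_of_vec m n (x + t \<cdot>\<^sub>v unit_vec (dim_vec x) k) $$ (i, j)
    = add_entry (mat_of_vec m n x) (k mod m) (k div m) t $$ (i, j)"
    using ij assms col_major_less[OF ij]
    by (auto simp: add_entry_def mat_of_vec_def)
qed (auto simp: add_entry_def mat_of_vec_def)

text \<open>
  The weight of the edge from \<open>u\<close> to \<open>v\<close>, as a function of the vectorized matrix. The swapped roles of
  rows and columns are those in \<open>\<partial>Y(p, q) / \<partial>X(a, b) = - Y(p, a) * Y(b, q)\<close>.
\<close>
definition inverse_edge :: "nat \<Rightarrow> real vec \<Rightarrow> nat \<Rightarrow> nat \<Rightarrow> real" where
  "inverse_edge d x u v = the (mat_inverse (mat_of_vec d d x)) $$ (v div d, u mod d)"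

lemma index_bounds: "u < d * d \<Longrightarrow> u mod d < d \<and> u div d < d" for d :: nat
  by (cases "d = 0") (auto simp: less_mult_imp_div_less)

context
  fixes d k :: nat and x :: "real vec"
  assumes x: "x \<in> carrier_vec (d * d)" "det (mat_of_vec d d x) \<noteq> 0" and k: "k < d * d"
begin

abbreviation (input) shifted :: "real \<Rightarrow> real vec" where
  "shifted t \<equiv> x + t \<cdot>\<^sub>v unit_vec (dim_vec x) k"

lemma det_shifted:
  "det (mat_of_vec d d (shifted t)) = det (mat_of_vec d d x) * (1 + t * inverse_edge d x k k)"
  unfolding mat_of_vec_add_unit[OF x(1) k] inverse_edge_def
  using det_add_entry[OF mat_of_vec_carrier x(2)] index_bounds[OF k] by auto

lemma shifted_0: "shifted 0 = x"
  by (rule eq_vecI) (use k x in auto)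

lemma has_derivative_det_shifted:
  "((\<lambda>t. det (mat_of_vec d d (shifted t))) has_real_derivative
     det (mat_of_vec d d x) * inverse_edge d x k k) (at 0)"
  unfolding det_shifted by (auto intro!: derivative_eq_intros)

lemma eventually_det_shifted:
  assumes "open U" "det (mat_of_vec d d x) \<in> U"
  shows "\<forall>\<^sub>F t in nhds 0. det (mat_of_vec d d (shifted t)) \<in> U"
proof -
  let ?f = "\<lambda>t. det (mat_of_vec d d (shifted t))"
  have "(?f \<longlongrightarrow> ?f 0) (nhds 0)"
    using DERIV_isCont[OF has_derivative_det_shifted]
    unfolding isCont_def tendsto_at_iff_tendsto_nhds[of ?f 0] .
  moreover have "?f 0 \<in> U" using assms(2) by (simp add: shifted_0)
  ultimately show ?thesis using assms(1) topological_tendstoD by blast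
qed

lemma has_derivative_inverse_edge:
  assumes "u < d * d" "v < d * d"
  shows "((\<lambda>t. inverse_edge d (shifted t) u v) has_real_derivative
    - inverse_edge d (shifted 0) u k * inverse_edge d (shifted 0) k v) (at 0)"
proof -
  define y where "y = inverse_edge d x k k"
  define c where "c = inverse_edge d x u k * inverse_edge d x k v"
  let ?g = "\<lambda>t. inverse_edge d x u v - t * c / (1 + t * y)"
  have "\<forall>\<^sub>F t in nhds 0. det (mat_of_vec d d (shifted t)) \<in> - {0}"
    using x(2) by (intro eventually_det_shifted) auto
  then have ev: "\<forall>\<^sub>F t in nhds 0. inverse_edge d (shifted t) u v = ?g t"
  proof eventually_elim
    case (elim t)
    then have "1 + t * y \<noteq> 0" by (auto simp: det_shifted y_def)
    then show ?case
      unfolding inverse_edge_def y_def c_def mat_of_vec_add_unit[OF x(1) k]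
      using mat_inverse_add_entry[OF mat_of_vec_carrier x(2), of "k mod d" "k div d" t]
        index_bounds[OF k] index_bounds[OF assms(1)] index_bounds[OF assms(2)]
      by (simp add: mult.commute mult.left_commute)
  qed
  have "(?g has_real_derivative - c) (at 0)"
    by (auto intro!: derivative_eq_intros)
  then have "((\<lambda>t. inverse_edge d (shifted t) u v) has_real_derivative - c) (at 0)"
    using DERIV_cong_ev[OF refl ev refl] by blast
  then show ?thesis by (simp add: shifted_0 c_def)
qed

end

lemma moment_empty: "0 \<notin> set ls \<Longrightarrow> moment n w ls {} = 1"
proof (induction ls)
  case (Cons l ls)
  have "moment n w (l # ls) {} = (\<Sum>j\<le>n. if j = 0 then 1 else 0)"
    unfolding moment_Cons set_exp_def
    using Cons by (intro sum.cong refl) (auto simp: set_conv_power_eq_0 sized_cumulant_def)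
  then show ?case by simp
qed (simp add: delta_empty_def)

text \<open>
  The list \<open>js\<close> consists of distinct labels, which \<open>\<kappa>\<close> maps to coordinates. The labels make the
  set functions applicable when a coordinate is differentiated more than once. Since \<open>\<kappa>\<close> is total and
  stays within the coordinates, the rule for edges holds for all labels.
\<close>
theorem has_partial_det:
  fixes f :: "real mat \<Rightarrow> real" and \<kappa> :: "'a \<Rightarrow> nat"
  assumes f: "\<And>X. X \<in> carrier_mat d d \<Longrightarrow> det X \<noteq> 0 \<Longrightarrow> f X = det X"
    and \<kappa>: "\<And>u. \<kappa> u < d * d"
  shows "distinct js \<Longrightarrow> length js \<le> n \<Longrightarrow> x \<in> carrier_vec (d * d) \<Longrightarrow> det (mat_of_vec d d x) \<noteq> 0 \<Longrightarrow>
    has_partial (\<lambda>x. f (mat_of_vec d d x)) (map \<kappa> js) x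
      (det (mat_of_vec d d x) * moment n (\<lambda>u v. inverse_edge d x (\<kappa> u) (\<kappa> v)) [1..<Suc n] (set js))"
proof (induction js arbitrary: x)
  case Nil
  then show ?case by (simp add: f moment_empty del: upt_Suc)
next
  case (Cons j js)
  note x = Cons.prems(3,4)
  let ?x = "\<lambda>t. x + t \<cdot>\<^sub>v unit_vec (dim_vec x) (\<kappa> j)"
  let ?w = "\<lambda>t u v. inverse_edge d (?x t) (\<kappa> u) (\<kappa> v)"
  let ?m = "\<lambda>t. moment n (?w t) [1..<Suc n]"
  let ?D = "\<lambda>t. det (mat_of_vec d d (?x t))"
  have x0: "?x 0 = x" by (rule shifted_0[OF x \<kappa>])
  have "\<forall>\<^sub>F t in nhds 0. ?D t \<in> - {0}"
    using x(2) by (intro eventually_det_shifted[OF x \<kappa>]) auto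
  then have "\<forall>\<^sub>F t in nhds 0. has_partial (\<lambda>x. f (mat_of_vec d d x)) (map \<kappa> js) (?x t)
      (?D t * ?m t (set js))"
  proof eventually_elim
    case (elim t)
    then show ?case using Cons.prems x by (intro Cons.IH) auto
  qed
  moreover have "((\<lambda>t. ?D t * ?m t (set js)) has_real_derivative
      ?D 0 * ?m 0 (set (j # js))) (at 0)"
  proof -
    have "((\<lambda>t. ?m t (set js)) has_real_derivative
        ?m 0 (insert j (set js)) - ?w 0 j j * ?m 0 (set js)) (at 0)"
      using Cons.prems distinct_card[of js]
      by (intro has_derivative_moment[where w = ?w] has_derivative_inverse_edge[OF x \<kappa> \<kappa> \<kappa>]) auto
    from DERIV_mult'[OF has_derivative_det_shifted[OF x \<kappa>, of j] this] show ?thesis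
      by (simp add: x0 algebra_simps del: upt_Suc)
  qed
  ultimately show ?case unfolding x0 by (auto simp del: upt_Suc)
qed

lemma has_derivative_ln_abs:
  fixes y :: real
  assumes "y \<noteq> 0"
  shows "((\<lambda>y. ln \<bar>y\<bar>) has_real_derivative 1 / y) (at y)"
proof -
  have "\<forall>\<^sub>F z in nhds y. z \<in> {z. 0 < z * y}"
    using assms by (intro eventually_nhds_in_open open_Collect_less continuous_intros)
      (simp add: zero_less_mult_iff linorder_neq_iff, blast)
  then have ev: "\<forall>\<^sub>F z in nhds y. ln \<bar>z\<bar> = ln (sgn y * z)"
    by eventually_elim (auto simp: abs_if sgn_if zero_less_mult_iff)
  have "((\<lambda>z. ln (sgn y * z)) has_real_derivative 1 / y) (at y)"
    using assms by (auto intro!: derivative_eq_intros simp: sgn_if)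
  then show ?thesis using DERIV_cong_ev[OF refl ev refl] by blast
qed

text \<open>
  The open set \<open>U\<close> of admissible values of the determinant treats \<open>log |X|\<close> on the matrices of
  positive determinant and \<open>log\<close> of the absolute value on all nonsingular matrices at once.
\<close>
theorem has_partial_ln_det:
  fixes f :: "real mat \<Rightarrow> real" and \<kappa> :: "'a \<Rightarrow> nat"
  assumes U: "open U" "0 \<notin> U"
    and f: "\<And>X. X \<in> carrier_mat d d \<Longrightarrow> det X \<in> U \<Longrightarrow> f X = ln \<bar>det X\<bar>"
    and \<kappa>: "\<And>u. \<kappa> u < d * d"
  shows "distinct js \<Longrightarrow> js \<noteq> [] \<Longrightarrow> x \<in> carrier_vec (d * d) \<Longrightarrow> det (mat_of_vec d d x) \<in> U \<Longrightarrow>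
    has_partial (\<lambda>x. f (mat_of_vec d d x)) (map \<kappa> js) x
      (cumulant (\<lambda>u v. inverse_edge d x (\<kappa> u) (\<kappa> v)) (set js))"
proof (induction js arbitrary: x)
  case Nil
  then show ?case by simp
next
  case (Cons j js)
  have x: "x \<in> carrier_vec (d * d)" "det (mat_of_vec d d x) \<noteq> 0" using Cons.prems U by auto
  let ?x = "\<lambda>t. x + t \<cdot>\<^sub>v unit_vec (dim_vec x) (\<kappa> j)"
  let ?w = "\<lambda>t u v. inverse_edge d (?x t) (\<kappa> u) (\<kappa> v)"
  let ?D = "\<lambda>t. det (mat_of_vec d d (?x t))"
  have x0: "?x 0 = x" by (rule shifted_0[OF x \<kappa>])
  have ev: "\<forall>\<^sub>F t in nhds 0. ?D t \<in> U"
    using Cons.prems by (intro eventually_det_shifted[OF x \<kappa> U(1)])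
  show ?case
  proof (cases "js = []")
    case True
    have "\<forall>\<^sub>F t in nhds 0. f (mat_of_vec d d (?x t)) = ln \<bar>?D t\<bar>"
      using ev by eventually_elim (simp add: f)
    moreover have "((\<lambda>t. ln \<bar>?D t\<bar>) has_real_derivative ?w 0 j j) (at 0)"
    proof -
      have "((\<lambda>y. ln \<bar>y\<bar>) has_real_derivative 1 / ?D 0) (at (?D 0))"
        using x(2) unfolding x0 by (rule has_derivative_ln_abs)
      from DERIV_chain2[OF this has_derivative_det_shifted[OF x \<kappa>, of j]] show ?thesis
        using x(2) by (simp add: x0)
    qed
    ultimately show ?thesis using True by (auto simp: x0)
  next
    case False
    have "\<forall>\<^sub>F t in nhds 0. has_partial (\<lambda>x. f (mat_of_vec d d x)) (map \<kappa> js) (?x t)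
        (cumulant (?w t) (set js))"
      using ev
    proof eventually_elim
      case (elim t)
      then show ?case using Cons.prems x False by (intro Cons.IH) auto
    qed
    moreover have "((\<lambda>t. cumulant (?w t) (set js)) has_real_derivative
        cumulant (?w 0) (insert j (set js))) (at 0)"
      using Cons.prems False
      by (intro has_derivative_cumulant[where w = ?w] has_derivative_inverse_edge[OF x \<kappa> \<kappa> \<kappa>]) auto
    ultimately show ?thesis unfolding x0 by auto
  qed
qed

section \<open>The action of the commutation and symmetrizer matrices\<close>

lemma commutation_mat_carrier: "commutation_mat m n \<in> carrier_mat (m * n) (m * n)"
  and commutation_mat_vec:
    "A \<in> carrier_mat m n \<Longrightarrow> commutation_mat m n *\<^sub>v vec_of_mat A = vec_of_mat (transpose_mat A)"
  using theI'[OF commutation_mat_ex1[of m n]] by (auto simp: commutation_mat_def)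

lemma commutation_mat_mult_nth:
  assumes u: "u \<in> carrier_vec (m * n)" and ab: "a < m" "b < n"
  shows "(commutation_mat m n *\<^sub>v u) $ (a * n + b) = u $ (b * m + a)"
proof -
  have p: "a * n + b < m * n" using col_major_less[OF ab(2,1)] by (simp add: mult.commute)
  have "commutation_mat m n *\<^sub>v u = vec_of_mat (transpose_mat (mat_of_vec m n u))"
    using commutation_mat_vec[of "mat_of_vec m n u" m n] vec_of_mat_of_vec[OF u] by simp
  then show ?thesis
    using p ab by (simp add: vec_of_mat_def mat_of_vec_def mult_add_div_mod mult.commute)
qed

lemma symmetrizer_mat_carrier: "symmetrizer_mat n r \<in> carrier_mat (n ^ r) (n ^ r)"
  and symmetrizer_mat_kron_vecs: "length vs = r \<Longrightarrow> set vs \<subseteq> carrier_vec n \<Longrightarrow>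
    fact r \<cdot>\<^sub>v (symmetrizer_mat n r *\<^sub>v kron_vecs vs) =
      vec (n ^ r) (\<lambda>p. \<Sum>\<sigma> | \<sigma> permutes {..<r}. kron_vecs (permute_list \<sigma> vs) $ p)"
  using theI'[OF symmetrizer_mat_ex1[of n r]] by (auto simp: symmetrizer_mat_def)

text \<open>
  The defining property speaks of Kronecker products only. Applied to products of unit vectors it
  yields the entries of the matrix, hence its action on every vector.
\<close>
lemma symmetrizer_mat_mult_nth:
  assumes u: "u \<in> carrier_vec (n ^ r)" and ks: "length ks = r" "set ks \<subseteq> {..<n}"
  shows "(symmetrizer_mat n r *\<^sub>v u) $ multi_pos n ks
    = (\<Sum>\<sigma> | \<sigma> permutes {..<r}. u $ multi_pos n (permute_list \<sigma> ks)) / fact r"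
proof -
  let ?S = "symmetrizer_mat n r" and ?p = "multi_pos n ks"
  note S = symmetrizer_mat_carrier[of n r]
  have p: "?p < n ^ r" using multi_pos_less[OF ks(2)] ks(1) by simp
  have perm: "multi_pos n (permute_list \<sigma> ks) < n ^ r" if "\<sigma> permutes {..<r}" for \<sigma>
    using multi_pos_less[of "permute_list \<sigma> ks" n] that ks by simp
  have entry: "fact r * ?S $$ (?p, q)
      = (\<Sum>\<sigma> | \<sigma> permutes {..<r}. if q = multi_pos n (permute_list (inv_into UNIV \<sigma>) ks) then 1 else 0)"
    if q: "q < n ^ r" for q
  proof -
    obtain ls where ls: "length ls = r" "set ls \<subseteq> {..<n}" "multi_pos n ls = q"
      using multi_pos_surj[OF q] by blast
    let ?vs = "map (unit_vec n) ls :: real vec list"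
    have vs: "length ?vs = r" "set ?vs \<subseteq> carrier_vec n" using ls by auto
    have unit: "kron_vecs ?vs = unit_vec (n ^ r) q" using kron_vecs_unit[OF ls(2)] ls by simp
    have "fact r * ?S $$ (?p, q) = (fact r \<cdot>\<^sub>v (?S *\<^sub>v kron_vecs ?vs)) $ ?p"
      unfolding unit using S p q by (simp add: scalar_prod_right_unit)
    also have "\<dots> = (\<Sum>\<sigma> | \<sigma> permutes {..<r}. kron_vecs (permute_list \<sigma> ?vs) $ ?p)"
      unfolding symmetrizer_mat_kron_vecs[OF vs] using p by simp
    also have "\<dots> = (\<Sum>\<sigma> | \<sigma> permutes {..<r}.
        if q = multi_pos n (permute_list (inv_into UNIV \<sigma>) ks) then 1 else 0)"
    proof (intro sum.cong refl)
      fix \<sigma> assume "\<sigma> \<in> {\<sigma>. \<sigma> permutes {..<r}}"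
      then have \<sigma>: "\<sigma> permutes {..<r}" by simp
      have "kron_vecs (permute_list \<sigma> ?vs) $ ?p
          = unit_vec (n ^ r) q $ multi_pos n (permute_list (inv_into UNIV \<sigma>) ks)"
        using kron_vecs_permute[OF vs(2) ks(2), of \<sigma>] vs(1) ks(1) \<sigma> by (simp add: unit)
      then show "kron_vecs (permute_list \<sigma> ?vs) $ ?p
          = (if q = multi_pos n (permute_list (inv_into UNIV \<sigma>) ks) then 1 else 0)"
        using perm[OF permutes_inv[OF \<sigma>]] q by auto
    qed
    finally show ?thesis .
  qed
  have "fact r * (?S *\<^sub>v u) $ ?p = (\<Sum>q<n ^ r. fact r * ?S $$ (?p, q) * u $ q)"
    using S p u by (simp add: scalar_prod_def atLeast0LessThan sum_distrib_left mult.assoc)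
  also have "\<dots> = (\<Sum>q<n ^ r. \<Sum>\<sigma> | \<sigma> permutes {..<r}.
      if q = multi_pos n (permute_list (inv_into UNIV \<sigma>) ks) then u $ q else 0)"
    by (intro sum.cong refl)
      (simp add: entry sum_distrib_right if_distrib[of "\<lambda>x. x * _"] cong: if_cong)
  also have "\<dots> = (\<Sum>\<sigma> | \<sigma> permutes {..<r}. \<Sum>q<n ^ r.
      if q = multi_pos n (permute_list (inv_into UNIV \<sigma>) ks) then u $ q else 0)"
    by (rule sum.swap)
  also have "\<dots> = (\<Sum>\<sigma> | \<sigma> permutes {..<r}. u $ multi_pos n (permute_list (inv_into UNIV \<sigma>) ks))"
    by (intro sum.cong refl) (simp add: perm permutes_inv)
  also have "\<dots> = (\<Sum>\<sigma> | \<sigma> permutes {..<r}. u $ multi_pos n (permute_list \<sigma> ks))"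
    by (rule sum_permutations_inverse[symmetric])
  finally show ?thesis by (simp add: field_simps)
qed

lemma sum_permutes_eq_sum_permutations_of_set:
  "(\<Sum>\<sigma> | \<sigma> permutes {..<r}. g (map \<sigma> [0..<r])) = (\<Sum>xs\<in>permutations_of_set {..<r}. g xs :: real)"
proof -
  let ?f = "\<lambda>\<sigma>. map \<sigma> [0..<r]" and ?P = "{\<sigma>. \<sigma> permutes {..<r}}"
  have inj: "inj_on ?f ?P"
  proof (rule inj_onI, rule ext)
    fix \<sigma> \<tau> i assume "\<sigma> \<in> ?P" "\<tau> \<in> ?P" "?f \<sigma> = ?f \<tau>"
    then show "\<sigma> i = \<tau> i" by (cases "i < r") (auto simp: permutes_not_in)
  qed
  have "?f ` ?P = permutations_of_set {..<r}"
  proof (rule card_subset_eq)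
    show "?f ` ?P \<subseteq> permutations_of_set {..<r}"
    proof safe
      fix \<sigma> assume \<sigma>: "\<sigma> permutes {..<r}"
      then show "map \<sigma> [0..<r] \<in> permutations_of_set {..<r}"
        using permutes_image[OF \<sigma>] permutes_inj_on[OF \<sigma>]
        by (auto intro!: permutations_of_setI simp: distinct_map atLeast0LessThan)
    qed
    show "card (?f ` ?P) = card (permutations_of_set {..<r})"
      by (simp add: card_image[OF inj] card_permutations)
  qed simp
  then show ?thesis using sum.reindex[OF inj, of g] by (simp add: o_def)
qed

section \<open>Kronecker products\<close>

lemma multi_pos_append:
  "multi_pos n (ks @ ls) = multi_pos n ks * n ^ length ls + multi_pos n ls"
  by (induction ks) (simp_all add: power_add algebra_simps)

lemma kron_vec_nth:
  assumes "p < dim_vec u" "q < dim_vec v"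
  shows "kron_vec u v $ (p * dim_vec v + q) = u $ p * v $ q"
  using col_major_less[of q "dim_vec v" p "dim_vec u"] assms
  by (simp add: kron_vec_def mult_add_div_mod mult.commute)

lemma kron_vec_pow_carrier: "y \<in> carrier_vec n \<Longrightarrow> kron_vec_pow y r \<in> carrier_vec (n ^ r)"
proof -
  assume "y \<in> carrier_vec n"
  then have "set (replicate r y) \<subseteq> carrier_vec n" by auto
  from kron_vecs_carrier[OF this] show ?thesis by (simp add: kron_vec_pow_def)
qed

lemma kron_vec_pow_Suc: "kron_vec_pow y (Suc r) = kron_vec y (kron_vec_pow y r)"
  by (simp add: kron_vec_pow_def kron_vecs_Cons)

lemma kron_vec_pow_nth:
  assumes "y \<in> carrier_vec n" "set ks \<subseteq> {..<n}" "length ks = r"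
  shows "kron_vec_pow y r $ multi_pos n ks = (\<Prod>k\<leftarrow>ks. y $ k)"
proof -
  have "set (replicate r y) \<subseteq> carrier_vec n" using assms(1) by auto
  then have "kron_vec_pow y r $ multi_pos n ks = (\<Prod>j<r. y $ (ks ! j))"
    unfolding kron_vec_pow_def using assms kron_vecs_nth[of ks "replicate r y" n] by simp
  also have "\<dots> = (\<Prod>k\<leftarrow>ks. y $ k)"
    by (simp add: prod.list_conv_set_nth assms(3) atLeast0LessThan)
  finally show ?thesis .
qed

lemma kron_vec_pow_add:
  assumes y: "y \<in> carrier_vec n"
  shows "kron_vec_pow y (r + s) = kron_vec (kron_vec_pow y r) (kron_vec_pow y s)"
proof (rule eq_vecI)
  have d: "dim_vec (kron_vec_pow y t) = n ^ t" for t
    using kron_vec_pow_carrier[OF y, of t] by simp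
  show "dim_vec (kron_vec_pow y (r + s)) = dim_vec (kron_vec (kron_vec_pow y r) (kron_vec_pow y s))"
    by (simp add: d kron_vec_def power_add)
  fix p assume "p < dim_vec (kron_vec (kron_vec_pow y r) (kron_vec_pow y s))"
  then have "p < n ^ (r + s)" by (simp add: d kron_vec_def power_add)
  then obtain ks where ks: "length ks = r + s" "set ks \<subseteq> {..<n}" "multi_pos n ks = p"
    using multi_pos_surj by blast
  define us vs where "us = take r ks" and "vs = drop r ks"
  have uv: "ks = us @ vs" "length us = r" "length vs = s" "set us \<subseteq> {..<n}" "set vs \<subseteq> {..<n}"
    using ks by (auto simp: us_def vs_def dest: in_set_takeD in_set_dropD)
  have "kron_vec (kron_vec_pow y r) (kron_vec_pow y s) $ p
      = kron_vec_pow y r $ multi_pos n us * kron_vec_pow y s $ multi_pos n vs"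
    using kron_vec_nth[of "multi_pos n us" "kron_vec_pow y r" "multi_pos n vs" "kron_vec_pow y s"]
      multi_pos_less[of us n] multi_pos_less[of vs n] uv ks by (simp add: d multi_pos_append)
  then show "kron_vec_pow y (r + s) $ p = kron_vec (kron_vec_pow y r) (kron_vec_pow y s) $ p"
    using kron_vec_pow_nth[OF y ks(2,1)] kron_vec_pow_nth[OF y, of us r] kron_vec_pow_nth[OF y, of vs s]
      uv ks(3) by simp
qed

lemma sum_div_mod: "(\<Sum>q<m * n. f (q div n) (q mod n)) = (\<Sum>i<m. \<Sum>j<n. f i j :: real)" for m n :: nat
proof -
  have "(\<Sum>i<m. \<Sum>j<n. f i j) = (\<Sum>(i, j)\<in>{..<m} \<times> {..<n}. f i j)"
    by (simp add: sum.cartesian_product)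
  also have "\<dots> = (\<Sum>q<m * n. f (q div n) (q mod n))"
  proof (rule sum.reindex_bij_witness[of _ "\<lambda>q. (q div n, q mod n)" "\<lambda>(i, j). i * n + j"])
    fix ij assume "ij \<in> {..<m} \<times> {..<n}"
    then obtain i j where "ij = (i, j)" "i < m" "j < n" by auto
    then show "((case ij of (i, j) \<Rightarrow> i * n + j) div n, (case ij of (i, j) \<Rightarrow> i * n + j) mod n) = ij"
      "(case ij of (i, j) \<Rightarrow> i * n + j) \<in> {..<m * n}"
      "f ((case ij of (i, j) \<Rightarrow> i * n + j) div n) ((case ij of (i, j) \<Rightarrow> i * n + j) mod n)
        = (case ij of (i, j) \<Rightarrow> f i j)"
      using col_major_less[of j n i m] by (simp_all add: mult_add_div_mod mult.commute)
  next
    fix q assume "q \<in> {..<m * n}"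
    then show "(q div n, q mod n) \<in> {..<m} \<times> {..<n}"
      by (cases n) (auto simp: less_mult_imp_div_less)
  qed auto
  finally show ?thesis ..
qed

lemma kron_mat_carrier:
  "A \<in> carrier_mat m n \<Longrightarrow> B \<in> carrier_mat m' n' \<Longrightarrow> kron_mat A B \<in> carrier_mat (m * m') (n * n')"
  by (auto simp: kron_mat_def)

lemma kron_mat_mult_kron_vec:
  assumes A: "A \<in> carrier_mat m n" and B: "B \<in> carrier_mat m' n'"
    and u: "u \<in> carrier_vec n" and v: "v \<in> carrier_vec n'"
  shows "kron_mat A B *\<^sub>v kron_vec u v = kron_vec (A *\<^sub>v u) (B *\<^sub>v v)"
proof (rule eq_vecI)
  show "dim_vec (kron_mat A B *\<^sub>v kron_vec u v) = dim_vec (kron_vec (A *\<^sub>v u) (B *\<^sub>v v))"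
    using A B by (simp add: kron_mat_def kron_vec_def)
  fix p assume "p < dim_vec (kron_vec (A *\<^sub>v u) (B *\<^sub>v v))"
  then have p: "p < m * m'" using A B by (simp add: kron_vec_def)
  then have pd: "p div m' < m" "p mod m' < m'"
    by (simp add: less_mult_imp_div_less) (use p in \<open>cases m', auto\<close>)
  have "(kron_mat A B *\<^sub>v kron_vec u v) $ p = (\<Sum>q<n * n'.
      A $$ (p div m', q div n') * B $$ (p mod m', q mod n') * (u $ (q div n') * v $ (q mod n')))"
    using A B u v p by (simp add: kron_mat_def kron_vec_def scalar_prod_def atLeast0LessThan)
  also have "\<dots> = (\<Sum>i<n. \<Sum>j<n'. A $$ (p div m', i) * B $$ (p mod m', j) * (u $ i * v $ j))"
    by (rule sum_div_mod)
  also have "\<dots> = (\<Sum>i<n. A $$ (p div m', i) * u $ i) * (\<Sum>j<n'. B $$ (p mod m', j) * v $ j)"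
    by (simp add: sum_product algebra_simps)
  also have "\<dots> = kron_vec (A *\<^sub>v u) (B *\<^sub>v v) $ p"
    using A B u v p pd by (simp add: kron_vec_def scalar_prod_def atLeast0LessThan)
  finally show "(kron_mat A B *\<^sub>v kron_vec u v) $ p = kron_vec (A *\<^sub>v u) (B *\<^sub>v v) $ p" .
qed

section \<open>Kronecker products of commutation matrices as products of closed walks\<close>

text \<open>
  The same weight as \<open>inverse_edge\<close>, for an arbitrary matrix in the place of the inverse.
\<close>
definition transposed_edge :: "nat \<Rightarrow> real mat \<Rightarrow> nat \<Rightarrow> nat \<Rightarrow> real" where
  "transposed_edge d Y u v = Y $$ (v div d, u mod d)"

text \<open>
  The position on the left has the base-\<open>d\<close> digits \<open>u mod d\<close>, then \<open>k div d\<close> and \<open>k mod d\<close> for each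
  \<open>k\<close> in \<open>ks\<close>, and finally \<open>v div d\<close>. Paired up from the left, they select the entries of \<open>Y\<close> along the
  walk from \<open>u\<close> through \<open>ks\<close> to \<open>v\<close>.
\<close>
lemma kron_vec_pow_shifted_nth:
  assumes Y: "Y \<in> carrier_mat d d"
  shows "set ks \<subseteq> {..<d * d} \<Longrightarrow> u < d * d \<Longrightarrow> v < d * d \<Longrightarrow>
    kron_vec_pow (vec_of_mat Y) (Suc (length ks))
      $ (((u mod d) * (d * d) ^ length ks + multi_pos (d * d) ks) * d + v div d)
    = walk (transposed_edge d Y) u ks v"
proof (induction ks arbitrary: u)
  have y: "vec_of_mat Y \<in> carrier_vec (d * d)" using Y by simp
  have dim: "dim_vec (kron_vec_pow (vec_of_mat Y) t) = (d * d) ^ t" for t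
    using kron_vec_pow_carrier[OF y, of t] by simp
  have edge: "vec_of_mat Y $ ((u mod d) * d + v div d) = transposed_edge d Y u v
      \<and> (u mod d) * d + v div d < d * d" if "u < d * d" "v < d * d" for u v
    using index_bounds[OF that(1)] index_bounds[OF that(2)] Y col_major_less[of "v div d" d "u mod d" d]
    by (auto simp: vec_of_mat_def transposed_edge_def)
  {
    case Nil
    then show ?case using kron_vec_nth[of "(u mod d) * d + v div d" "vec_of_mat Y" 0 "kron_vec_pow (vec_of_mat Y) 0"]
        edge[of u v] dim[of 0] y by (simp add: kron_vec_pow_Suc kron_vec_pow_def kron_vecs_def)
  next
    case (Cons x ks)
    let ?N = "(d * d) ^ Suc (length ks)"
    let ?q = "((x mod d) * (d * d) ^ length ks + multi_pos (d * d) ks) * d + v div d"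
    have x: "x < d * d" "set ks \<subseteq> {..<d * d}" using Cons.prems by auto
    have "(x mod d) * (d * d) ^ length ks + multi_pos (d * d) ks < d * (d * d) ^ length ks"
      using col_major_less[OF multi_pos_less[OF x(2)], of "x mod d" d] index_bounds[OF x(1)]
      by (simp add: mult.commute)
    from col_major_less[OF _ this, of "v div d" d]
    have q: "?q < ?N" using index_bounds[OF Cons.prems(3)] by (simp add: ac_simps)
    obtain A B where AB: "x div d = A" "x mod d = B" "x = A * d + B" by (metis div_mult_mod_eq)
    have "(((u mod d) * (d * d) ^ length (x # ks) + multi_pos (d * d) (x # ks)) * d + v div d)
        = ((u mod d) * d + x div d) * ?N + ?q"
      unfolding AB(1,2) by (simp add: AB(3) algebra_simps)
    then show ?case
      using kron_vec_nth[of "(u mod d) * d + x div d" "vec_of_mat Y" ?q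
          "kron_vec_pow (vec_of_mat Y) (Suc (length ks))"]
        edge[of u x] Cons.IH[OF x(2,1) Cons.prems(3)] Cons.prems q dim[of "Suc (length ks)"] y
      by (simp add: kron_vec_pow_Suc[of _ "Suc (length ks)"] add.assoc)
  }
qed

lemma odd_power_mult: "l \<ge> 1 \<Longrightarrow> d * d ^ (2 * l - 1) = (d * d) ^ l" for d :: nat
  by (cases l) (simp_all add: power_mult_distrib power_add[symmetric] mult_2 mult_2_right)

text \<open>
  The commutation matrix moves the leading base-\<open>d\<close> digit of \<open>multi_pos (d * d) ks\<close>, the column of
  the first coordinate, to the end. There it closes the walk.
\<close>
lemma commutation_mat_kron_vec_pow:
  assumes Y: "Y \<in> carrier_mat d d" and ks: "set ks \<subseteq> {..<d * d}" "length ks = l" "l \<ge> 1"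
  shows "(commutation_mat d (d ^ (2 * l - 1)) *\<^sub>v kron_vec_pow (vec_of_mat Y) l) $ multi_pos (d * d) ks
    = closed_walk (transposed_edge d Y) ks"
proof -
  obtain k ls where k: "ks = k # ls" "length ls = l - 1" using ks by (cases ks) auto
  let ?n = "d ^ (2 * l - 1)" and ?M = "(d * d) ^ (l - 1)"
  have kb: "k < d * d" "set ls \<subseteq> {..<d * d}" using ks k by auto
  have n: "?n = d * ?M" using ks(3)
    by (cases l) (simp_all add: power_mult_distrib power_add[symmetric] mult_2 mult_2_right)
  let ?b = "(k mod d) * ?M + multi_pos (d * d) ls"
  have b: "?b < ?n"
    using col_major_less[OF multi_pos_less[OF kb(2)], of "k mod d" d] index_bounds[OF kb(1)] k(2)
    unfolding n by (simp add: mult.commute)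
  obtain A B where AB: "k div d = A" "k mod d = B" "k = A * d + B" by (metis div_mult_mod_eq)
  have pos: "multi_pos (d * d) ks = (k div d) * ?n + ?b"
    unfolding n AB(1,2) by (simp add: k AB(3) algebra_simps)
  have y: "kron_vec_pow (vec_of_mat Y) l \<in> carrier_vec (d * ?n)"
    unfolding odd_power_mult[OF ks(3)] using Y by (intro kron_vec_pow_carrier) simp
  show ?thesis
    unfolding pos commutation_mat_mult_nth[OF y conjunct2[OF index_bounds[OF kb(1)]] b]
    using kron_vec_pow_shifted_nth[OF Y kb(2,1,1)] k ks(3) by (simp add: closed_walk_def)
qed

lemma block_walks_append:
  "block_walks w (bl @ bl') xs = block_walks w bl (take (sum_list bl) xs) * block_walks w bl' (drop (sum_list bl) xs)"
  by (induction bl arbitrary: xs) (simp_all add: min_def drop_take add.commute)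

text \<open>
  This property passes from the factors to a Kronecker product while the lists of blocks are
  appended. So the nested Kronecker products in \<open>Xi_mat\<close> need no associativity law.
\<close>
definition acts_by_blocks :: "nat \<Rightarrow> real mat \<Rightarrow> real mat \<Rightarrow> nat list \<Rightarrow> bool" where
  "acts_by_blocks d Y M bl \<longleftrightarrow>
     M \<in> carrier_mat ((d * d) ^ sum_list bl) ((d * d) ^ sum_list bl) \<and>
     (\<forall>ks. length ks = sum_list bl \<and> set ks \<subseteq> {..<d * d} \<longrightarrow>
        (M *\<^sub>v kron_vec_pow (vec_of_mat Y) (sum_list bl)) $ multi_pos (d * d) ks
          = block_walks (transposed_edge d Y) bl ks)"

lemma acts_by_blocks_one: "acts_by_blocks d Y (1\<^sub>m 1) []"
  by (auto simp: acts_by_blocks_def kron_vec_pow_def kron_vecs_def)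

lemma acts_by_blocks_commutation_mat:
  assumes "Y \<in> carrier_mat d d" "l \<ge> 1"
  shows "acts_by_blocks d Y (commutation_mat d (d ^ (2 * l - 1))) [l]"
  using assms commutation_mat_carrier[of d "d ^ (2 * l - 1)"]
  by (auto simp: acts_by_blocks_def commutation_mat_kron_vec_pow odd_power_mult simp del: One_nat_def)

lemma acts_by_blocks_kron_mat:
  assumes Y: "Y \<in> carrier_mat d d" and A: "acts_by_blocks d Y A bl" and B: "acts_by_blocks d Y B bl'"
  shows "acts_by_blocks d Y (kron_mat A B) (bl @ bl')"
proof -
  let ?r = "sum_list bl" and ?s = "sum_list bl'" and ?N = "d * d" and ?y = "kron_vec_pow (vec_of_mat Y)"
  have y: "vec_of_mat Y \<in> carrier_vec ?N" using Y by simp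
  have car: "A \<in> carrier_mat (?N ^ ?r) (?N ^ ?r)" "B \<in> carrier_mat (?N ^ ?s) (?N ^ ?s)"
    using A B by (auto simp: acts_by_blocks_def)
  have "(kron_mat A B *\<^sub>v ?y (?r + ?s)) $ multi_pos ?N ks
      = block_walks (transposed_edge d Y) (bl @ bl') ks"
    if ks: "length ks = ?r + ?s" "set ks \<subseteq> {..<?N}" for ks
  proof -
    define us vs where "us = take ?r ks" and "vs = drop ?r ks"
    have uv: "ks = us @ vs" "length us = ?r" "length vs = ?s" "set us \<subseteq> {..<?N}" "set vs \<subseteq> {..<?N}"
      using ks by (auto simp: us_def vs_def dest: in_set_takeD in_set_dropD)
    have "(kron_mat A B *\<^sub>v ?y (?r + ?s)) $ multi_pos ?N ks
        = kron_vec (A *\<^sub>v ?y ?r) (B *\<^sub>v ?y ?s) $ multi_pos ?N ks"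
      unfolding kron_vec_pow_add[OF y]
      by (subst kron_mat_mult_kron_vec[OF car kron_vec_pow_carrier[OF y] kron_vec_pow_carrier[OF y]]) simp
    also have "\<dots> = (A *\<^sub>v ?y ?r) $ multi_pos ?N us * (B *\<^sub>v ?y ?s) $ multi_pos ?N vs"
      using kron_vec_nth[of "multi_pos ?N us" "A *\<^sub>v ?y ?r" "multi_pos ?N vs" "B *\<^sub>v ?y ?s"]
        multi_pos_less[OF uv(4)] multi_pos_less[OF uv(5)] uv car
      by (simp add: multi_pos_append)
    also have "\<dots> = block_walks (transposed_edge d Y) bl us * block_walks (transposed_edge d Y) bl' vs"
      using A B uv by (simp add: acts_by_blocks_def)
    finally show ?thesis using uv by (simp add: block_walks_append)
  qed
  then show ?thesis
    using kron_mat_carrier[OF car] by (simp add: acts_by_blocks_def power_add)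
qed

lemma acts_by_blocks_kron_mat_pow:
  assumes Y: "Y \<in> carrier_mat d d" and A: "acts_by_blocks d Y A [l]"
  shows "acts_by_blocks d Y (kron_mat_pow A m) (replicate m l)"
proof (induction m)
  case 0
  then show ?case using acts_by_blocks_one by (simp add: kron_mat_pow_def kron_mats_def)
next
  case (Suc m)
  then show ?case
    using acts_by_blocks_kron_mat[OF Y A Suc] by (simp add: kron_mat_pow_def kron_mats_def)
qed

lemma acts_by_blocks_kron_mats:
  assumes Y: "Y \<in> carrier_mat d d"
  shows "0 \<notin> set ls \<Longrightarrow> acts_by_blocks d Y
    (kron_mats (map (\<lambda>l. kron_mat_pow (commutation_mat d (d ^ (2 * l - 1))) (m l)) ls)) (blocks m ls)"
proof (induction ls)
  case Nil
  then show ?case using acts_by_blocks_one by (simp add: kron_mats_def)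
next
  case (Cons l ls)
  then have "acts_by_blocks d Y (kron_mat_pow (commutation_mat d (d ^ (2 * l - 1))) (m l)) (replicate (m l) l)"
    by (intro acts_by_blocks_kron_mat_pow acts_by_blocks_commutation_mat Y) simp
  from acts_by_blocks_kron_mat[OF Y this Cons.IH] Cons.prems show ?case by (simp add: kron_mats_def)
qed

section \<open>The vectorized derivatives\<close>

lemma walk_map: "walk w (\<kappa> u) (map \<kappa> xs) (\<kappa> v) = walk (\<lambda>u v. w (\<kappa> u) (\<kappa> v)) u xs v"
  by (induction xs arbitrary: u) simp_all

lemma closed_walk_map: "closed_walk w (map \<kappa> xs) = closed_walk (\<lambda>u v. w (\<kappa> u) (\<kappa> v)) xs"
  by (cases xs) (simp_all add: closed_walk_def walk_map)

lemma block_walks_map: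
  "block_walks w bl (map \<kappa> xs) = block_walks (\<lambda>u v. w (\<kappa> u) (\<kappa> v)) bl xs"
  by (induction bl arbitrary: xs) (simp_all add: closed_walk_map take_map drop_map)

text \<open>
  The positions \<open>0, \<dots>, r - 1\<close> of a multi-index serve as labels, so that repeated coordinates get
  different labels.
\<close>
lemma has_mat_derivI:
  fixes X :: "real mat"
  assumes X: "X \<in> carrier_mat d d" "d \<ge> 1" and v: "v \<in> carrier_vec ((d * d) ^ r)"
    and partial: "\<And>\<kappa>. (\<And>u. \<kappa> u < d * d) \<Longrightarrow>
      has_partial (\<lambda>x. f (mat_of_vec d d x)) (map \<kappa> [0..<r]) (vec_of_mat X)
        (v $ multi_pos (d * d) (map \<kappa> [0..<r]))"
  shows "has_mat_deriv r f X v"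
  unfolding has_mat_deriv_def has_vec_deriv_def
proof (intro conjI allI impI)
  have dim: "dim_vec (vec_of_mat X) = d * d" using X by (simp add: vec_of_mat_def)
  show "v \<in> carrier_vec (dim_vec (vec_of_mat X) ^ r)" using v by (simp add: dim)
  fix ks assume ks: "length ks = r \<and> set ks \<subseteq> {..<dim_vec (vec_of_mat X)}"
  \<comment> \<open>Labels that do not occur go to coordinate 0, which exists because \<open>d\<close> is positive.\<close>
  define \<kappa> where "\<kappa> j = (if j < r then ks ! j else 0)" for j
  have "ks ! u < d * d" if "u < r" for u
    using ks that nth_mem[of u ks] unfolding dim by blast
  then have "\<kappa> u < d * d" for u using X(2) by (simp add: \<kappa>_def)
  moreover have "map \<kappa> [0..<r] = ks" using ks by (intro nth_equalityI) (auto simp: \<kappa>_def)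
  ultimately have "has_partial (\<lambda>x. f (mat_of_vec d d x)) ks (vec_of_mat X) (v $ multi_pos (d * d) ks)"
    using partial[of \<kappa>] by simp
  then show "has_partial (\<lambda>x. f (mat_of_vec (dim_row X) (dim_col X) x)) ks (vec_of_mat X)
      (v $ multi_pos (dim_vec (vec_of_mat X)) ks)"
    using X by (simp add: dim)
qed

lemma symmetrizer_mat_mult_nth_map:
  assumes u: "u \<in> carrier_vec (n ^ r)" and \<kappa>: "\<And>j. \<kappa> j < n"
  shows "(symmetrizer_mat n r *\<^sub>v u) $ multi_pos n (map \<kappa> [0..<r])
    = (\<Sum>xs\<in>permutations_of_set {..<r}. u $ multi_pos n (map \<kappa> xs)) / fact r"
proof -
  have "permute_list \<sigma> (map \<kappa> [0..<r]) = map \<kappa> (map \<sigma> [0..<r])" if "\<sigma> permutes {..<r}" for \<sigma>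
    using permutes_in_image[OF that] by (auto simp: permute_list_def)
  then have "(\<Sum>\<sigma> | \<sigma> permutes {..<r}. u $ multi_pos n (permute_list \<sigma> (map \<kappa> [0..<r])))
      = (\<Sum>\<sigma> | \<sigma> permutes {..<r}. u $ multi_pos n (map \<kappa> (map \<sigma> [0..<r])))"
    by (intro sum.cong) auto
  also have "\<dots> = (\<Sum>xs\<in>permutations_of_set {..<r}. u $ multi_pos n (map \<kappa> xs))"
    by (rule sum_permutes_eq_sum_permutations_of_set)
  finally show ?thesis
    using symmetrizer_mat_mult_nth[OF u, of "map \<kappa> [0..<r]"] \<kappa> by auto
qed

lemma inverse_edge_vec_of_mat:
  "X \<in> carrier_mat d d \<Longrightarrow> inverse_edge d (vec_of_mat X) = transposed_edge d (the (mat_inverse X))"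
  by (simp add: fun_eq_iff inverse_edge_def transposed_edge_def mat_of_vec_of_mat)

theorem has_mat_deriv_ln_det:
  fixes X :: "real mat"
  assumes "d \<ge> 1" "r \<ge> 1" and U: "open U" "0 \<notin> U"
    and f: "\<And>X. X \<in> carrier_mat d d \<Longrightarrow> det X \<in> U \<Longrightarrow> f X = ln \<bar>det X\<bar>"
    and X: "X \<in> carrier_mat d d" "det X \<in> U"
  shows "has_mat_deriv r f X
    (((-1) ^ (r - 1) * fact (r - 1)) \<cdot>\<^sub>v
      (symmetrizer_mat (d\<^sup>2) r *\<^sub>v
        (commutation_mat d (d ^ (2 * r - 1)) *\<^sub>v
          kron_vec_pow (vec_of_mat (the (mat_inverse X))) r)))"
  unfolding power2_eq_square
proof (rule has_mat_derivI[OF X(1) assms(1)])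
  let ?Y = "the (mat_inverse X)" and ?N = "d * d"
  let ?u = "commutation_mat d (d ^ (2 * r - 1)) *\<^sub>v kron_vec_pow (vec_of_mat ?Y) r"
  let ?S = "symmetrizer_mat ?N r"
  have det: "det X \<noteq> 0" using X U by auto
  note Y = mat_inverse_nonsingular(1)[OF X(1) det]
  have S: "?S \<in> carrier_mat (?N ^ r) (?N ^ r)" by (rule symmetrizer_mat_carrier)
  have u: "?u \<in> carrier_vec (?N ^ r)"
    using commutation_mat_carrier[of d "d ^ (2 * r - 1)"]
    unfolding odd_power_mult[OF \<open>r \<ge> 1\<close>] by (rule mult_mat_vec_carrier) (simp add: Y kron_vec_pow_carrier)
  show "((-1) ^ (r - 1) * fact (r - 1)) \<cdot>\<^sub>v (?S *\<^sub>v ?u) \<in> carrier_vec (?N ^ r)"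
    using S u by simp
  fix \<kappa> :: "nat \<Rightarrow> nat" assume \<kappa>: "\<And>j. \<kappa> j < ?N"
  let ?ks = "map \<kappa> [0..<r]" and ?w = "\<lambda>u v. transposed_edge d ?Y (\<kappa> u) (\<kappa> v)"
  have pos: "multi_pos ?N ?ks < ?N ^ r" using multi_pos_less[of ?ks ?N] \<kappa> by auto
  have "(?S *\<^sub>v ?u) $ multi_pos ?N ?ks = cycle_sum ?w {..<r} / fact r"
    unfolding symmetrizer_mat_mult_nth_map[OF u \<kappa>] cycle_sum_def
  proof (intro arg_cong2[where f = "(/)"] sum.cong refl)
    fix xs assume "xs \<in> permutations_of_set {..<r}"
    then have "length (map \<kappa> xs) = r" using length_finite_permutations_of_set by fastforce
    then show "?u $ multi_pos ?N (map \<kappa> xs) = closed_walk ?w xs"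
      unfolding closed_walk_map[symmetric]
      using \<kappa> by (intro commutation_mat_kron_vec_pow Y) (use assms(2) in auto)
  qed
  moreover have "(fact r :: real) = real r * fact (r - 1)" using \<open>r \<ge> 1\<close> by (simp add: fact_reduce)
  ultimately have "(((-1) ^ (r - 1) * fact (r - 1)) \<cdot>\<^sub>v (?S *\<^sub>v ?u)) $ multi_pos ?N ?ks
      = cumulant ?w {..<r}"
    using S u pos by (simp add: cumulant_def)
  then show "has_partial (\<lambda>x. f (mat_of_vec d d x)) ?ks (vec_of_mat X)
      ((((-1) ^ (r - 1) * fact (r - 1)) \<cdot>\<^sub>v (?S *\<^sub>v ?u)) $ multi_pos ?N ?ks)"
    using has_partial_ln_det[OF U f \<kappa>, of "[0..<r]" "vec_of_mat X"] \<open>r \<ge> 1\<close> X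
    by (simp add: mat_of_vec_of_mat inverse_edge_vec_of_mat atLeast0LessThan)
qed

theorem has_mat_deriv_det:
  fixes X :: "real mat"
  assumes "d \<ge> 1"
    and f: "\<And>X. X \<in> carrier_mat d d \<Longrightarrow> det X \<noteq> 0 \<Longrightarrow> f X = det X"
    and X: "X \<in> carrier_mat d d" "det X \<noteq> 0"
  shows "has_mat_deriv r f X
    (det X \<cdot>\<^sub>v
      (symmetrizer_mat (d\<^sup>2) r *\<^sub>v
        (Xi_mat d r *\<^sub>v kron_vec_pow (vec_of_mat (the (mat_inverse X))) r)))"
  unfolding power2_eq_square
proof (rule has_mat_derivI[OF X(1) assms(1)])
  let ?Y = "the (mat_inverse X)" and ?N = "d * d"
  let ?y = "kron_vec_pow (vec_of_mat ?Y) r"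
  let ?S = "symmetrizer_mat ?N r" and ?ls = "[1..<Suc r]"
  let ?K = "\<lambda>m. kron_mats (map (\<lambda>l. kron_mat_pow (commutation_mat d (d ^ (2 * l - 1))) (m l)) ?ls)"
  let ?c = "\<lambda>m. (-1) ^ (r - (\<Sum>l=1..r. m l)) * (fact r / (\<Prod>l=1..r. fact (m l) * real l ^ m l))"
  note Y = mat_inverse_nonsingular(1)[OF X]
  have y: "?y \<in> carrier_vec (?N ^ r)" using Y by (simp add: kron_vec_pow_carrier)
  have N: "d ^ (2 * r) = ?N ^ r" by (simp add: power_mult power2_eq_square)
  have S: "?S \<in> carrier_mat (?N ^ r) (?N ^ r)" by (rule symmetrizer_mat_carrier)
  have Xi: "Xi_mat d r \<in> carrier_mat (?N ^ r) (?N ^ r)" by (simp add: Xi_mat_def N)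
  have u: "Xi_mat d r *\<^sub>v ?y \<in> carrier_vec (?N ^ r)" using Xi y by simp
  show "det X \<cdot>\<^sub>v (?S *\<^sub>v (Xi_mat d r *\<^sub>v ?y)) \<in> carrier_vec (?N ^ r)" using S u by simp
  have K: "?K m \<in> carrier_mat (?N ^ r) (?N ^ r)"
    "length ks = r \<Longrightarrow> set ks \<subseteq> {..<?N} \<Longrightarrow>
      (?K m *\<^sub>v ?y) $ multi_pos ?N ks = block_walks (transposed_edge d ?Y) (blocks m ?ls) ks"
    if "m \<in> weight_tuples r" for m ks
  proof -
    have "sum_list (blocks m ?ls) = r"
      unfolding sum_list_blocks sum_list_upt_Suc using that by (simp add: weight_tuples_def)
    moreover have "acts_by_blocks d ?Y (?K m) (blocks m ?ls)"
      by (intro acts_by_blocks_kron_mats Y) simp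
    ultimately show "?K m \<in> carrier_mat (?N ^ r) (?N ^ r)"
      "length ks = r \<Longrightarrow> set ks \<subseteq> {..<?N} \<Longrightarrow>
        (?K m *\<^sub>v ?y) $ multi_pos ?N ks = block_walks (transposed_edge d ?Y) (blocks m ?ls) ks"
      unfolding acts_by_blocks_def by auto
  qed
  fix \<kappa> :: "nat \<Rightarrow> nat" assume \<kappa>: "\<And>j. \<kappa> j < ?N"
  let ?ks = "map \<kappa> [0..<r]" and ?w = "\<lambda>u v. transposed_edge d ?Y (\<kappa> u) (\<kappa> v)"
  have pos: "multi_pos ?N ?ks < ?N ^ r" using multi_pos_less[of ?ks ?N] \<kappa> by auto
  have entry: "(Xi_mat d r *\<^sub>v ?y) $ multi_pos ?N (map \<kappa> xs)
      = (\<Sum>m\<in>weight_tuples r. ?c m * block_walks ?w (blocks m ?ls) xs)"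
    if xs: "xs \<in> permutations_of_set {..<r}" for xs
  proof -
    have len: "length (map \<kappa> xs) = r" "set (map \<kappa> xs) \<subseteq> {..<?N}"
      using length_finite_permutations_of_set[OF xs] \<kappa> by auto
    define p where "p = multi_pos ?N (map \<kappa> xs)"
    have p: "p < ?N ^ r" using multi_pos_less[OF len(2)] len(1) by (simp add: p_def)
    have "(Xi_mat d r *\<^sub>v ?y) $ p
        = (\<Sum>q<?N ^ r. (\<Sum>m\<in>weight_tuples r. ?c m * ?K m $$ (p, q)) * ?y $ q)"
      using p y by (simp add: Xi_mat_def N scalar_prod_def atLeast0LessThan del: upt_Suc One_nat_def)
    also have "\<dots> = (\<Sum>m\<in>weight_tuples r. ?c m * (\<Sum>q<?N ^ r. ?K m $$ (p, q) * ?y $ q))"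
      unfolding sum_distrib_left sum_distrib_right mult.assoc by (rule sum.swap)
    also have "\<dots> = (\<Sum>m\<in>weight_tuples r. ?c m * (?K m *\<^sub>v ?y) $ p)"
    proof (intro sum.cong refl arg_cong2[where f = "(*)"])
      fix m assume "m \<in> weight_tuples r"
      from K(1)[OF this] show "(\<Sum>q<?N ^ r. ?K m $$ (p, q) * ?y $ q) = (?K m *\<^sub>v ?y) $ p"
        using p y by (simp add: scalar_prod_def atLeast0LessThan del: upt_Suc One_nat_def)
    qed
    also have "\<dots> = (\<Sum>m\<in>weight_tuples r. ?c m * block_walks ?w (blocks m ?ls) xs)"
      unfolding p_def by (intro sum.cong refl) (simp only: K(2)[OF _ len] block_walks_map)
    finally show ?thesis unfolding p_def .
  qed
  have "(?S *\<^sub>v (Xi_mat d r *\<^sub>v ?y)) $ multi_pos ?N ?ks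
      = (\<Sum>xs\<in>permutations_of_set {..<r}.
          \<Sum>m\<in>weight_tuples r. ?c m * block_walks ?w (blocks m ?ls) xs) / fact r"
    unfolding symmetrizer_mat_mult_nth_map[OF u \<kappa>]
    by (intro arg_cong2[where f = "(/)"] sum.cong refl entry)
  also have "\<dots> = (\<Sum>m\<in>weight_tuples r. ?c m
      * (\<Sum>xs\<in>permutations_of_set {..<r}. block_walks ?w (blocks m ?ls) xs)) / fact r"
    unfolding sum_distrib_left by (subst sum.swap) (rule refl)
  also have "\<dots> = (\<Sum>m\<in>weight_tuples r. (-1) ^ (r - (\<Sum>l=1..r. m l)) / (\<Prod>l=1..r. fact (m l) * real l ^ m l)
      * (\<Sum>xs\<in>permutations_of_set {..<r}. block_walks ?w (blocks m ?ls) xs))"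
    unfolding sum_divide_distrib by (intro sum.cong refl) simp
  also have "\<dots> = moment r ?w ?ls {..<r}"
    by (rule moment_eq_sum_weight_tuples[symmetric]) simp_all
  finally have "(det X \<cdot>\<^sub>v (?S *\<^sub>v (Xi_mat d r *\<^sub>v ?y))) $ multi_pos ?N ?ks
      = det X * moment r ?w ?ls {..<r}"
    using S u pos by simp
  then show "has_partial (\<lambda>x. f (mat_of_vec d d x)) ?ks (vec_of_mat X)
      ((det X \<cdot>\<^sub>v (?S *\<^sub>v (Xi_mat d r *\<^sub>v ?y))) $ multi_pos ?N ?ks)"
    using has_partial_det[OF f \<kappa>, of "[0..<r]" r "vec_of_mat X"] X
    by (simp add: mat_of_vec_of_mat inverse_edge_vec_of_mat atLeast0LessThan del: upt_Suc)
qed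

theorem theorem9:
  fixes d r :: nat
  assumes "d \<ge> 1" and "r \<ge> 1"
  shows
    "(\<forall>f :: real mat \<Rightarrow> real.
        (\<forall>X \<in> carrier_mat d d. det X > 0 \<longrightarrow> f X = ln (det X)) \<longrightarrow>
        (\<forall>X \<in> carrier_mat d d. det X > 0 \<longrightarrow>
           has_mat_deriv r f X
             (((-1) ^ (r - 1) * fact (r - 1)) \<cdot>\<^sub>v
               (symmetrizer_mat (d\<^sup>2) r *\<^sub>v
                 (commutation_mat d (d ^ (2 * r - 1)) *\<^sub>v
                   kron_vec_pow (vec_of_mat (the (mat_inverse X))) r))))) \<and>
     (\<forall>f :: real mat \<Rightarrow> real.
        (\<forall>X \<in> carrier_mat d d. det X \<noteq> 0 \<longrightarrow> f X = ln \<bar>det X\<bar>) \<longrightarrow>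
        (\<forall>X \<in> carrier_mat d d. det X \<noteq> 0 \<longrightarrow>
           has_mat_deriv r f X
             (((-1) ^ (r - 1) * fact (r - 1)) \<cdot>\<^sub>v
               (symmetrizer_mat (d\<^sup>2) r *\<^sub>v
                 (commutation_mat d (d ^ (2 * r - 1)) *\<^sub>v
                   kron_vec_pow (vec_of_mat (the (mat_inverse X))) r))))) \<and>
     (\<forall>f :: real mat \<Rightarrow> real.
        (\<forall>X \<in> carrier_mat d d. det X \<noteq> 0 \<longrightarrow> f X = det X) \<longrightarrow>
        (\<forall>X \<in> carrier_mat d d. det X \<noteq> 0 \<longrightarrow>
           has_mat_deriv r f X
             (det X \<cdot>\<^sub>v
               (symmetrizer_mat (d\<^sup>2) r *\<^sub>v
                 (Xi_mat d r *\<^sub>v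
                   kron_vec_pow (vec_of_mat (the (mat_inverse X))) r)))))"
proof (intro conjI allI impI ballI)
  fix f :: "real mat \<Rightarrow> real" and X :: "real mat"
  assume "\<forall>X \<in> carrier_mat d d. det X > 0 \<longrightarrow> f X = ln (det X)" "X \<in> carrier_mat d d" "det X > 0"
  then show "has_mat_deriv r f X
             (((-1) ^ (r - 1) * fact (r - 1)) \<cdot>\<^sub>v
               (symmetrizer_mat (d\<^sup>2) r *\<^sub>v
                 (commutation_mat d (d ^ (2 * r - 1)) *\<^sub>v
                   kron_vec_pow (vec_of_mat (the (mat_inverse X))) r)))"
    using assms by (intro has_mat_deriv_ln_det[where U = "{0<..}"]) auto
next
  fix f :: "real mat \<Rightarrow> real" and X :: "real mat"
  assume "\<forall>X \<in> carrier_mat d d. det X \<noteq> 0 \<longrightarrow> f X = ln \<bar>det X\<bar>" "X \<in> carrier_mat d d" "det X \<noteq> 0"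
  then show "has_mat_deriv r f X
             (((-1) ^ (r - 1) * fact (r - 1)) \<cdot>\<^sub>v
               (symmetrizer_mat (d\<^sup>2) r *\<^sub>v
                 (commutation_mat d (d ^ (2 * r - 1)) *\<^sub>v
                   kron_vec_pow (vec_of_mat (the (mat_inverse X))) r)))"
    using assms by (intro has_mat_deriv_ln_det[where U = "- {0}"]) auto
next
  fix f :: "real mat \<Rightarrow> real" and X :: "real mat"
  assume "\<forall>X \<in> carrier_mat d d. det X \<noteq> 0 \<longrightarrow> f X = det X" "X \<in> carrier_mat d d" "det X \<noteq> 0"
  then show "has_mat_deriv r f X
             (det X \<cdot>\<^sub>v
               (symmetrizer_mat (d\<^sup>2) r *\<^sub>v
                 (Xi_mat d r *\<^sub>v
                   kron_vec_pow (vec_of_mat (the (mat_inverse X))) r)))"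
    using assms by (intro has_mat_deriv_det) auto
qed

end
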